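(* For every $\alpha\in(0,1)$, $\gamma>0$ and every real $t\neq0$, one has $$\hat{\mathbf{X}}_{\alpha,\gamma}^{\,t}\ \text{is } M\text{-det}\quad\Longleftrightarrow\quad0<t\le2\gamma\quad\Longleftrightarrow\quad\mathbf{X}_{\alpha,\gamma}^{-t}\ \text{is } M\text{-det}.$$
   Context: For $\alpha\in(0,1)$ and $\gamma>0$: The random variable $\mathbf{X}_{\alpha,\gamma}$ ($\alpha$-Sun random variable, Fréchet case) is the positive random variable whose smooth probability density $h_{\alpha,\gamma}$ on $(0,\infty)$ solves $$h_{\alpha,\gamma}(x)=\frac{\gamma}{x}\int_0^x\frac{h_{\alpha,\gamma}(u)}{(x-\alpha u)^{\gamma}}\,du,\qquad x>0.$$ The random variable $\hat{\mathbf{X}}_{\alpha,\gamma}$ (Weibull case, up to sign) is the positive random variable whose probability density $\hat h_{\alpha,\gamma}$ on $(0,\infty)$ solves $$\hat h_{\alpha,\gamma}(x)=\frac{\gamma}{x}\int_x^{x/\alpha}(x-\alpha u)^{\gamma}\,\hat h_{\alpha,\gamma}(u)\,du,\qquad x>0.$$ (It is known that such densities exist, and each equation together with the normalization $\int_0^\infty=1$ determines the law.) A positive random variable $X$ is called $M$-det (moment-determinate) if all its positive integer moments $\mathbb{E}[X^n]$, $n\ge1$, are finite and characterize its law, i.e. the law of $X$ is the only probability law on $[0,\infty)$ with these moments. In particular a positive random variable with some infinite positive integer moment is not $M$-det. *)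

theory Defs
  imports "HOL-Probability.Probability"
begin

definition smooth_on_pos :: "(real \<Rightarrow> real) \<Rightarrow> bool" where
  "smooth_on_pos h \<longleftrightarrow> (\<forall>n. \<forall>x>0. (deriv ^^ n) h field_differentiable (at x))"

(* The values of h outside (0, infinity) are irrelevant: the indicator puts the law on the
   half-line. Integrability of the integrands in the two equations below is automatic, since
   the kernels are bounded on the range of integration. *)
definition has_pos_density :: "'a measure \<Rightarrow> ('a \<Rightarrow> real) \<Rightarrow> (real \<Rightarrow> real) \<Rightarrow> bool" where
  "has_pos_density M X h \<longleftrightarrow>
     prob_space M \<and> (\<forall>x>0. 0 \<le> h x) \<and>
     distributed M lborel X (\<lambda>x. ennreal (h x * indicator {0<..} x))"

definition sun_frechet :: "real \<Rightarrow> real \<Rightarrow> 'a measure \<Rightarrow> ('a \<Rightarrow> real) \<Rightarrow> bool" where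
  "sun_frechet \<alpha> \<gamma> M X \<longleftrightarrow>
     (\<exists>h. has_pos_density M X h \<and> smooth_on_pos h \<and>
       (\<forall>x>0. h x = \<gamma> / x * (LBINT u:{0<..<x}. h u / (x - \<alpha> * u) powr \<gamma>)))"

definition sun_weibull :: "real \<Rightarrow> real \<Rightarrow> 'a measure \<Rightarrow> ('a \<Rightarrow> real) \<Rightarrow> bool" where
  "sun_weibull \<alpha> \<gamma> M X \<longleftrightarrow>
     (\<exists>h. has_pos_density M X h \<and>
       (\<forall>x>0. h x = \<gamma> / x * (LBINT u:{x<..<x / \<alpha>}. (x - \<alpha> * u) powr \<gamma> * h u)))"

(* Determinacy in the Stieltjes sense: the competing laws live on [0, infinity). *)
definition M_det :: "'a measure \<Rightarrow> ('a \<Rightarrow> real) \<Rightarrow> bool" where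
  "M_det M X \<longleftrightarrow>
     (\<forall>n\<ge>1. integrable M (\<lambda>\<omega>. X \<omega> ^ n)) \<and>
     (\<forall>\<nu>::real measure.
        prob_space \<nu> \<and> sets \<nu> = sets borel \<and> (AE x in \<nu>. 0 \<le> x) \<and>
        (\<forall>n\<ge>1. integrable \<nu> (\<lambda>x. x ^ n) \<and>
               (\<integral>x. x ^ n \<partial>\<nu>) = (\<integral>\<omega>. X \<omega> ^ n \<partial>M))
        \<longrightarrow> \<nu> = distr M borel X)"

end

(* Put Z = X'^\<gamma> (Weibull case) or Z = X^(-\<gamma>) (Frechet case). The integral equation bounds the
   hazard rate of Z: its density f satisfies a P(Z > z) <= f z <= b P(Z > z) for large z. The lower bound
   on f makes exp (\<epsilon> Z) integrable, so for r <= 2 Hardy's criterion shows that Z^r is determinate: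
   \<pm>Z^(r/2) has a characteristic function that is holomorphic in a strip, hence fixed by the moments.
   The upper bound on f gives P(Z > z) >= exp (- 2 b z) / 2, and so for r > 2 the density of Z^r is at
   least exp (- C y^\<theta>) for large y, with \<theta> = 1/r < 1/2. Such a density absorbs a small multiple of a
   Stieltjes function exp (- b u^\<theta>) sin (b' u^\<theta>), u = y - a, which is orthogonal to all polynomials on
   (a, \<infinity>); this gives another law with the same moments.
   For negative powers the same perturbation applies, because near 0 the density of X' decays slower
   than exp (- x^(-p)) for every p > 0, and the density of X has a polynomial tail at infinity. *)
theory Submission
  imports Defs "HOL-Complex_Analysis.Complex_Analysis" "HOL-Real_Asymp.Real_Asymp"
begin

section \<open>Indeterminacy by Stieltjes perturbations\<close>

text \<open>The kernels have size \<open>x powr (- \<gamma>)\<close> and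
  \<open>x powr \<gamma>\<close>, which is why \<open>X powr (- \<gamma>)\<close> and
  \<open>X' powr \<gamma>\<close> are the powers whose hazard rate is of order one. In the Frechet
  case \<open>x - \<alpha> * u\<close> stays between \<open>(1 - \<alpha>) * x\<close> and
  \<open>x\<close> on the whole range, so both hazard bounds are immediate. The obstacle is the
  lower bound in the Weibull case: the kernel vanishes as \<open>u\<close> approaches
  \<open>x / \<alpha>\<close> and sees nothing beyond, so a fixed share of the mass above
  \<open>x\<close> must be shown to lie where the kernel is large. For this the half-line is cut
  into geometric blocks, and the equation bounds the mass of a block below by a multiple of
  \<open>y powr \<gamma>\<close> times the mass of the next block. For large \<open>y\<close> this
  factor is at least 2 and tails halve from block to block; iterated towards 0, the same inequality
  limits how fast the density can decay there. Tails are compared over finite steps rather than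
  differentiated.\<close>

lemma powr_poly_exp_tendsto_0:
  fixes a c \<theta> :: real and n :: nat
  assumes "0 < c" "0 < \<theta>" "0 \<le> a"
  shows "((\<lambda>u. u * (a + u) ^ n * exp (- c * u powr \<theta>)) \<longlongrightarrow> 0) at_top"
    and "((\<lambda>u. u * (a + u) ^ n * exp (- c * u powr \<theta>)) \<longlongrightarrow> 0) (at_right 0)"
proof -
  show "((\<lambda>u. u * (a + u) ^ n * exp (- c * u powr \<theta>)) \<longlongrightarrow> 0) at_top"
    using assms by real_asymp
  have "eventually (\<lambda>x::real. 0 \<le> x) (at_right 0)"
    by (simp add: eventually_at_right_less less_imp_le eventually_mono[OF eventually_at_right_less])
  then show "((\<lambda>u. u * (a + u) ^ n * exp (- c * u powr \<theta>)) \<longlongrightarrow> 0) (at_right 0)"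
    using assms by (auto intro!: tendsto_eq_intros)
qed

text \<open>Up to the factor \<open>- u\<close>, the integrand is the imaginary part of the entire function \<open>K\<close> at
  \<open>ln u - \<i> * pi\<close>, and \<open>K\<close> is real on the real axis. With a primitive \<open>P\<close> of \<open>K\<close> this makes
  \<open>Im (P (ln u) - P (ln u - \<i> * pi))\<close> an antiderivative of the integrand, and it vanishes at both ends.\<close>

lemma stieltjes_kernel_moments_zero:
  fixes a b \<theta> :: real and n :: nat
  assumes \<theta>: "0 < \<theta>" "\<theta> < 1/2" and b: "0 < b" and a: "0 \<le> a"
  defines "L \<equiv> \<lambda>u. exp (- b * cos (pi * \<theta>) * u powr \<theta>) * sin (b * sin (pi * \<theta>) * u powr \<theta>)"
  assumes int: "set_integrable lborel {0<..} (\<lambda>u. (a + u) ^ n * L u)"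
  shows "(LBINT u:{0<..}. (a + u) ^ n * L u) = 0"
proof -
  \<comment> \<open>In the variable z = exp w this is (a - z)^n exp (- b z^\<theta>) dz; the leading
    \<open>exp w\<close> is the Jacobian. Passing to w makes the fractional power entire, and the
    line Im w = - pi represents z = - u without a branch cut.\<close>
  define K where "K w = exp w * (of_real a - exp w) ^ n * exp (- of_real b * exp (of_real \<theta> * w))" for w :: complex
  have "K holomorphic_on UNIV"
    unfolding K_def by (intro holomorphic_intros)
  then obtain P where P: "\<And>w. (P has_field_derivative K w) (at w)"
    using holomorphic_convex_primitive'[of UNIV K] by auto
  define Q where "Q u = Im (P (of_real (ln u)) - P (of_real (ln u) - \<i> * pi))" for u :: real
  define c where "c = b * cos (pi * \<theta>)"
  \<comment> \<open>This is where \<open>\<theta> < 1/2\<close> is decisive: the exponential still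
    decays on the line Im w = - pi.\<close>
  have cpos: "0 < c" unfolding c_def using \<theta> b by (intro mult_pos_pos cos_gt_zero) auto
  define B where "B u = u * (a + u) ^ n * exp (- c * u powr \<theta>)" for u
  \<comment> \<open>On a vertical segment the modulus of \<open>exp w\<close> is constant, and the
    cosine governing the decay is smallest at the lower end, so one bound serves the whole
    segment.\<close>
  have Kbound: "norm (K w) \<le> B (exp (Re w))" if "w \<in> closed_segment (of_real v) (of_real v - \<i> * pi)" for w v
  proof -
    from that obtain s where s: "0 \<le> s" "s \<le> 1" and w: "w = of_real v - \<i> * (s * pi)"
      by (auto simp: closed_segment_def algebra_simps scaleR_conv_of_real)
    have Rw: "Re w = v" and Iw: "Im w = - (s * pi)" by (simp_all add: w)
    have "cos (pi * \<theta>) \<le> cos (\<theta> * (s * pi))"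
    proof (rule cos_monotone_0_pi_le)
      show "\<theta> * (s * pi) \<le> pi * \<theta>" using s \<theta> mult_left_le[of s "\<theta> * pi"] by (simp add: mult_ac)
      show "pi * \<theta> \<le> pi" using \<theta> by simp
    qed (use s \<theta> in auto)
    then have "exp (\<theta> * v) * cos (pi * \<theta>) \<le> exp (\<theta> * v) * cos (\<theta> * (s * pi))"
      by (intro mult_left_mono) auto
    then have e: "norm (exp (- of_real b * exp (of_real \<theta> * w))) \<le> exp (- c * exp v powr \<theta>)"
      using b by (simp add: Re_exp Rw Iw c_def powr_def mult_ac)
    have "norm (of_real a - exp w) \<le> a + exp v"
      using norm_triangle_ineq4[of "of_real a" "exp w"] a by (simp add: Rw)
    then have "norm (of_real a - exp w) ^ n \<le> (a + exp v) ^ n" by (intro power_mono) auto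
    then show ?thesis
      unfolding K_def B_def norm_mult norm_power Rw
      using e a by (intro mult_mono) (auto simp: Rw)
  qed
  have Qb: "norm (Q u) \<le> B u * pi" if "0 < u" for u
  proof -
    have "norm (P (of_real (ln u)) - P (of_real (ln u) - \<i> * pi))
        \<le> B u * norm (of_real (ln u) - (of_real (ln u) - \<i> * pi))"
    proof (rule field_differentiable_bound[where f' = K])
      fix z assume z: "z \<in> closed_segment (complex_of_real (ln u)) (complex_of_real (ln u) - \<i> * complex_of_real pi)"
      then have "Re z = ln u"
        by (auto simp: closed_segment_def) (simp add: algebra_simps)
      then show "norm (K z) \<le> B u" using Kbound[OF z] that by simp
    qed (auto intro: has_field_derivative_at_within P)
    then have "norm (P (of_real (ln u)) - P (of_real (ln u) - \<i> * pi)) \<le> B u * pi"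
      by (simp add: norm_mult)
    then show ?thesis unfolding Q_def
      using abs_Im_le_cmod order_trans by (metis real_norm_def)
  qed
  have Q_lim: "(Q \<longlongrightarrow> 0) at_top" "(Q \<longlongrightarrow> 0) (at_right 0)"
  proof -
    note B_lim = powr_poly_exp_tendsto_0[OF cpos \<theta>(1) a, of n, folded B_def]
    show "(Q \<longlongrightarrow> 0) at_top"
      by (rule Lim_null_comparison[OF _ tendsto_mult_left_zero[OF B_lim(1)]])
         (use Qb in \<open>auto intro: eventually_mono[OF eventually_gt_at_top[of 0]]\<close>)
    show "(Q \<longlongrightarrow> 0) (at_right 0)"
      by (rule Lim_null_comparison[OF _ tendsto_mult_left_zero[OF B_lim(2)]])
         (use Qb in \<open>auto intro: eventually_mono[OF eventually_at_right_less]\<close>)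
  qed
  have K1: "Im (K (of_real (ln u))) = 0" for u
  proof -
    have "K (of_real v) = of_real (exp v * (a - exp v) ^ n * exp (- b * exp (\<theta> * v)))" for v
      unfolding K_def by (simp flip: exp_of_real)
    then show ?thesis by simp
  qed
  have K2: "Im (K (of_real (ln u) - \<i> * pi)) = - u * ((a + u) ^ n * L u)" if "0 < u" for u
  proof -
    have e1: "exp (of_real (ln u) - \<i> * pi) = - of_real u"
      using that by (simp add: exp_diff exp_of_real)
    have e2: "exp (of_real \<theta> * (of_real (ln u) - \<i> * pi)) = Complex (u powr \<theta> * cos (pi * \<theta>)) (- (u powr \<theta>) * sin (pi * \<theta>))"
      using that by (simp add: complex_eq_iff Re_exp Im_exp powr_def mult_ac)
    have e3: "exp (- of_real b * Complex (u powr \<theta> * cos (pi * \<theta>)) (- (u powr \<theta>) * sin (pi * \<theta>)))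
       = exp (- b * cos (pi * \<theta>) * u powr \<theta>) * cis (b * sin (pi * \<theta>) * u powr \<theta>)"
      by (simp add: complex_eq_iff Re_exp Im_exp mult_ac)
    have "K (of_real (ln u) - \<i> * pi) = of_real (- u * (a + u) ^ n * exp (- b * cos (pi * \<theta>) * u powr \<theta>)) * cis (b * sin (pi * \<theta>) * u powr \<theta>)"
      unfolding K_def e1 e2 e3 by simp
    then show ?thesis by (simp add: L_def)
  qed
  have dQ: "(Q has_real_derivative (a + u) ^ n * L u) (at u)" if u: "0 < u" for u
  proof -
    have "((\<lambda>u. P (of_real (ln u)) - P (of_real (ln u) - \<i> * pi)) has_vector_derivative
        (of_real (1/u) * K (of_real (ln u)) - of_real (1/u) * K (of_real (ln u) - \<i> * pi))) (at u)"
    proof (intro has_vector_derivative_diff)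
      have 1: "((\<lambda>u. complex_of_real (ln u)) has_vector_derivative of_real (1/u)) (at u)"
        using u by (intro has_vector_derivative_of_real) (auto intro!: derivative_eq_intros)
      have 2: "((\<lambda>u. complex_of_real (ln u) - \<i> * pi) has_vector_derivative of_real (1/u)) (at u)"
        using has_vector_derivative_diff[OF 1 has_vector_derivative_const[of "\<i> * pi"]] by simp
      show "((\<lambda>u. P (of_real (ln u))) has_vector_derivative of_real (1/u) * K (of_real (ln u))) (at u)"
        using field_vector_diff_chain_at[OF 1 P] by (simp only: o_def)
      show "((\<lambda>u. P (of_real (ln u) - \<i> * pi)) has_vector_derivative of_real (1/u) * K (of_real (ln u) - \<i> * pi)) (at u)"
        using field_vector_diff_chain_at[OF 2 P] by (simp only: o_def)
    qed
    then have "(Q has_real_derivative Im (of_real (1/u) * K (of_real (ln u)) - of_real (1/u) * K (of_real (ln u) - \<i> * pi))) (at u)"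
      unfolding Q_def has_real_derivative_iff_has_vector_derivative
      by (intro bounded_linear.has_vector_derivative[OF bounded_linear_Im])
    also have "Im (of_real (1/u) * K (of_real (ln u)) - of_real (1/u) * K (of_real (ln u) - \<i> * pi)) = (a + u) ^ n * L u"
      using u K1[of u] K2[OF u] by (simp del: of_real_divide)
    finally show ?thesis .
  qed
  have "(LBINT u=0..\<infinity>. (a + u) ^ n * L u) = 0 - 0"
  proof (rule interval_integral_FTC_integrable[where F = Q])
    show "(Q has_vector_derivative (a + x) ^ n * L x) (at x)" if "0 < ereal x" for x
      using dQ that by (simp add: has_real_derivative_iff_has_vector_derivative)
    show "isCont (\<lambda>u. (a + u) ^ n * L u) x" if "0 < ereal x" for x
      using that unfolding L_def by (intro continuous_intros) auto
    show "set_integrable lborel (einterval 0 \<infinity>) (\<lambda>u. (a + u) ^ n * L u)"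
      using int by (simp add: einterval_def greaterThan_def)
    show "((Q \<circ> real_of_ereal) \<longlongrightarrow> 0) (at_right 0)"
      using Q_lim(2) by (simp add: zero_ereal_def ereal_tendsto_simps)
    show "((Q \<circ> real_of_ereal) \<longlongrightarrow> 0) (at_left \<infinity>)"
      using Q_lim(1) by (simp add: ereal_tendsto_simps)
  qed auto
  then show ?thesis
    by (simp add: interval_lebesgue_integral_def einterval_def greaterThan_def)
qed

text \<open>Division by \<open>(x + y) powr \<theta>\<close> reduces this to s <= s^\<theta> for 0 <
  s <= 1. It allows a stretched exponential in \<open>y\<close> to be compared with one in the
  shifted variable \<open>y - a\<close>.\<close>

lemma powr_add_le:
  fixes x y \<theta> :: real
  assumes "0 \<le> x" "0 \<le> y" "0 \<le> \<theta>" "\<theta> \<le> 1"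
  shows "(x + y) powr \<theta> \<le> x powr \<theta> + y powr \<theta>"
proof (cases "x = 0 \<or> y = 0")
  case False
  then have xy: "0 < x" "0 < y" using assms by auto
  have *: "z / (x + y) \<le> (z / (x + y)) powr \<theta>" if "0 < z" "z \<le> x + y" for z
    using powr_mono'[of \<theta> 1 "z / (x + y)"] that xy assms by (simp add: divide_le_eq)
  have "1 = x / (x + y) + y / (x + y)" using xy by (simp flip: add_divide_distrib)
  also have "\<dots> \<le> (x / (x + y)) powr \<theta> + (y / (x + y)) powr \<theta>"
    using xy by (intro add_mono *) auto
  also have "\<dots> = (x powr \<theta> + y powr \<theta>) / (x + y) powr \<theta>"
    using xy by (simp add: powr_divide add_divide_distrib)
  finally show ?thesis using xy by (simp add: le_divide_eq)
qed (use assms in auto)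

text \<open>Nothing is known about \<open>f\<close> off the positive half-line, so integrals over
  the whole line are taken of the truncation \<open>p\<close>.\<close>

lemma has_pos_density_facts:
  assumes "has_pos_density M Y f"
  defines "p \<equiv> \<lambda>y. f y * indicator {0<..} y"
  shows "p \<in> borel_measurable borel" "\<And>y. 0 \<le> p y" "distr M borel Y = density lborel (\<lambda>y. ennreal (p y))"
    "Y \<in> borel_measurable M" "prob_space M" "\<And>x. 0 < x \<Longrightarrow> 0 \<le> f x"
    "integrable lborel p" "(\<integral>y. p y \<partial>lborel) = 1" "AE x in M. 0 < Y x"
proof -
  have d: "distributed M lborel Y (\<lambda>y. ennreal (p y))" and f: "\<And>x. 0 < x \<Longrightarrow> 0 \<le> f x"
    and M: "prob_space M"
    using assms by (auto simp: has_pos_density_def)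
  show "prob_space M" "\<And>x. 0 < x \<Longrightarrow> 0 \<le> f x" by fact+
  show p0: "0 \<le> p y" for y using f by (auto simp: p_def split: split_indicator)
  from distributed_real_measurable[OF _ d] p0 show p: "p \<in> borel_measurable borel" by simp
  show Y: "Y \<in> borel_measurable M" using distributed_measurable[OF d] by simp
  have "distr M borel Y = distr M lborel Y" by (intro distr_cong) auto
  also have "\<dots> = density lborel (\<lambda>y. ennreal (p y))" using d by (simp add: distributed_distr_eq_density)
  finally show D: "distr M borel Y = density lborel (\<lambda>y. ennreal (p y))" .
  interpret M: prob_space M by fact
  have "prob_space (density lborel (\<lambda>y. ennreal (p y)))"
    using M.prob_space_distr[OF Y] D by simp
  from prob_space.emeasure_space_1[OF this] have "(\<integral>\<^sup>+y. ennreal (p y) \<partial>lborel) = 1"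
    using p by (simp add: emeasure_density)
  then show "integrable lborel p" "(\<integral>y. p y \<partial>lborel) = 1"
    using p p0 by (auto intro!: integrableI_nonneg simp: integral_eq_nn_integral)
  have "AE y in distr M borel Y. 0 < y"
    unfolding D using p p0 by (subst AE_density) (auto simp: p_def split: split_indicator_asm)
  then show "AE x in M. 0 < Y x"
    using Y by (simp add: AE_distr_iff)
qed

text \<open>The perturbation \<open>k\<close> is dominated by the density \<open>p\<close>, so
  \<open>p + k\<close> is again nonnegative. Orthogonality to all powers preserves the moments, and
  its case \<open>n = 0\<close> preserves the total mass. The new law differs because
  \<open>k\<close> has no zero just to the right of \<open>a\<close>.\<close>

lemma not_M_det_of_density_ge:
  fixes f :: "real \<Rightarrow> real" and a c C \<theta> :: real
  assumes d: "has_pos_density M Y f" and \<theta>: "0 < \<theta>" "\<theta> < 1/2" and a: "0 \<le> a" and c: "0 < c"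
    and lower: "\<And>y. a < y \<Longrightarrow> c * exp (- C * y powr \<theta>) \<le> f y"
  shows "\<not> M_det M Y"
proof
  assume det: "M_det M Y"
  define p where "p y = f y * indicator {0<..} y" for y :: real
  note F = has_pos_density_facts[OF d, folded p_def]
  note [measurable] = F(1,4)
  have p0: "0 \<le> p y" for y by (rule F(2))
  \<comment> \<open>\<open>B\<close> dominates \<open>C\<close>, and the summand 1 keeps it
    positive. The frequency parameter \<open>b\<close> is then fixed by requiring that the real part
    of the exponent decay at rate exactly \<open>B\<close>.\<close>
  define B where "B = \<bar>C\<bar> + 1"
  have cpos: "0 < cos (pi * \<theta>)" using \<theta> by (intro cos_gt_zero) auto
  have spos: "0 < sin (pi * \<theta>)" using \<theta> by (intro sin_gt_zero) auto
  define b where "b = B / cos (pi * \<theta>)"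
  have b: "0 < b" "b * cos (pi * \<theta>) = B" using cpos by (auto simp: b_def B_def)
  define L where "L u = exp (- b * cos (pi * \<theta>) * u powr \<theta>) * sin (b * sin (pi * \<theta>) * u powr \<theta>)" for u
  have [measurable]: "L \<in> borel_measurable borel" unfolding L_def by measurable
  \<comment> \<open>The exponential factor pays for the shift from \<open>y\<close> to
    \<open>y - a\<close> through \<open>powr_add_le\<close>.\<close>
  define \<epsilon> where "\<epsilon> = c * exp (- B * a powr \<theta>)"
  have \<epsilon>: "0 < \<epsilon>" using c by (simp add: \<epsilon>_def)
  define k where "k y = indicator {a<..} y * (\<epsilon> * L (y - a))" for y
  have [measurable]: "k \<in> borel_measurable borel" unfolding k_def by measurable
  have k_le: "\<bar>k y\<bar> \<le> p y" for y
  proof (cases "a < y")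
    case True
    have "y powr \<theta> \<le> (y - a) powr \<theta> + a powr \<theta>"
      using powr_add_le[of "y - a" a \<theta>] True a \<theta> by simp
    then have "B * y powr \<theta> \<le> B * ((y - a) powr \<theta> + a powr \<theta>)" by (intro mult_left_mono) (auto simp: B_def)
    moreover have "C * y powr \<theta> \<le> B * y powr \<theta>" by (intro mult_right_mono) (auto simp: B_def)
    ultimately have *: "- B * a powr \<theta> + - B * (y - a) powr \<theta> \<le> - C * y powr \<theta>" by (simp add: algebra_simps)
    have "\<bar>k y\<bar> \<le> \<epsilon> * exp (- B * (y - a) powr \<theta>)"
      using True \<epsilon> b by (simp add: k_def L_def abs_mult mult_left_le)
    also have "\<dots> = c * exp (- B * a powr \<theta> + - B * (y - a) powr \<theta>)"
      unfolding exp_add \<epsilon>_def by simp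
    also have "\<dots> \<le> c * exp (- C * y powr \<theta>)" using * c by simp
    also have "\<dots> \<le> p y" using lower[OF True] True a by (simp add: p_def)
    finally show ?thesis .
  qed (simp add: k_def p0)
  have int_p: "integrable lborel (\<lambda>y. p y * y ^ n)" for n
  proof (cases "n = 0")
    case False
    then have "integrable M (\<lambda>\<omega>. Y \<omega> ^ n)" using det by (simp add: M_det_def)
    then have "integrable (distr M borel Y) (\<lambda>y. y ^ n)" by (simp add: integrable_distr_eq)
    then show ?thesis unfolding F(3) by (simp add: integrable_density p0)
  qed (use F(7) in simp)
  have int_k: "integrable lborel (\<lambda>y. k y * y ^ n)" for n
    by (rule Bochner_Integration.integrable_bound[OF int_p[of n]])
       (auto simp: abs_mult p0 intro!: mult_mono k_le)
  have zero: "(\<integral>y. k y * y ^ n \<partial>lborel) = 0" for n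
  proof -
    have eq: "k (a + u) * (a + u) ^ n = \<epsilon> * (indicator {0<..} u *\<^sub>R ((a + u) ^ n * L u))" for u
      by (simp add: k_def split: split_indicator)
    have "integrable lborel (\<lambda>u. k (a + 1 * u) * (a + 1 * u) ^ n)"
      by (subst lborel_integrable_real_affine_iff) (auto intro: int_k)
    then have "set_integrable lborel {0<..} (\<lambda>u. (a + u) ^ n * L u)"
      using \<epsilon> by (simp add: eq set_integrable_def)
    from stieltjes_kernel_moments_zero[OF \<theta> b(1) a this[unfolded L_def], folded L_def]
    have "(LBINT u:{0<..}. (a + u) ^ n * L u) = 0" .
    then have "(\<integral>u. k (a + 1 * u) * (a + 1 * u) ^ n \<partial>lborel) = 0"
      by (simp add: eq set_lebesgue_integral_def)
    then show ?thesis
      by (subst lborel_integral_real_affine[of 1 _ a]) auto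
  qed
  have pk: "0 \<le> p y + k y" for y using k_le[of y] by linarith
  define \<nu> where "\<nu> = density lborel (\<lambda>y. ennreal (p y + k y))"
  have int_\<nu>: "integrable \<nu> (\<lambda>y. y ^ n)" for n
    unfolding \<nu>_def using pk int_p[of n] int_k[of n] by (simp add: integrable_density distrib_right)
  have mom: "(\<integral>y. y ^ n \<partial>\<nu>) = (\<integral>\<omega>. Y \<omega> ^ n \<partial>M)" for n
  proof -
    have "(\<integral>y. y ^ n \<partial>\<nu>) = (\<integral>y. p y * y ^ n + k y * y ^ n \<partial>lborel)"
      unfolding \<nu>_def using pk by (simp add: integral_density distrib_right)
    also have "\<dots> = (\<integral>y. p y * y ^ n \<partial>lborel)" using int_p int_k zero by simp
    also have "\<dots> = (\<integral>y. y ^ n \<partial>distr M borel Y)" unfolding F(3) using p0 by (simp add: integral_density)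
    also have "\<dots> = (\<integral>\<omega>. Y \<omega> ^ n \<partial>M)" by (simp add: integral_distr)
    finally show ?thesis .
  qed
  have "prob_space \<nu>"
  proof
    have "emeasure \<nu> (space \<nu>) = (\<integral>\<^sup>+y. ennreal (p y + k y) \<partial>lborel)"
      by (simp add: \<nu>_def emeasure_density)
    also have "\<dots> = ennreal (\<integral>y. p y + k y \<partial>lborel)"
      using int_p[of 0] int_k[of 0] pk by (intro nn_integral_eq_integral) auto
    also have "(\<integral>y. p y + k y \<partial>lborel) = 1"
      using int_p[of 0] int_k[of 0] zero[of 0] F(8) by simp
    finally show "emeasure \<nu> (space \<nu>) = 1" by simp
  qed
  moreover have "AE x in \<nu>. 0 \<le> x"
  proof -
    have "0 \<le> x" if "0 < p x + k x" for x
      using that k_le[of x] by (cases "0 < x") (auto simp: p_def)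
    then show ?thesis unfolding \<nu>_def by (subst AE_density) auto
  qed
  moreover have "sets \<nu> = sets borel" by (simp add: \<nu>_def)
  ultimately have "\<nu> = distr M borel Y"
    using det mom int_\<nu> unfolding M_det_def by blast
  then have "density lborel (\<lambda>y. ennreal (p y + k y)) = density lborel (\<lambda>y. ennreal (p y))"
    using F(3) by (simp add: \<nu>_def)
  then have "AE y in lborel. ennreal (p y + k y) = ennreal (p y)"
    by (intro sigma_finite_measure.density_unique[OF sigma_finite_lborel]) auto
  then have AE0: "AE y in lborel. k y = 0"
    by eventually_elim (use p0 pk in \<open>simp add: ennreal_inj\<close>)
  \<comment> \<open>Close to 0 the argument of the sine lies strictly between 0 and pi, which makes
    \<open>k\<close> nonzero on an interval of positive length.\<close>
  have "((\<lambda>u. b * sin (pi * \<theta>) * u powr \<theta>) \<longlongrightarrow> 0) (at_right 0)"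
    using \<theta> by (auto intro!: tendsto_eq_intros eventually_mono[OF eventually_at_right_less] simp: less_imp_le)
  then have "eventually (\<lambda>u. b * sin (pi * \<theta>) * u powr \<theta> < pi) (at_right 0)"
    by (rule order_tendstoD) simp
  then obtain \<delta> where \<delta>: "0 < \<delta>" "\<And>u. 0 < u \<Longrightarrow> u < \<delta> \<Longrightarrow> b * sin (pi * \<theta>) * u powr \<theta> < pi"
    by (auto simp: eventually_at_right_field)
  have "k y \<noteq> 0" if "y \<in> {a<..<a + \<delta>}" for y
  proof -
    have "0 < sin (b * sin (pi * \<theta>) * (y - a) powr \<theta>)"
      using that b spos \<delta>(2)[of "y - a"] by (intro sin_gt_zero) auto
    then show ?thesis using that \<epsilon> by (simp add: k_def L_def)
  qed
  with AE0 have "AE y in lborel. y \<notin> {a<..<a + \<delta>}" by (auto elim: eventually_mono)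
  then have "emeasure lborel {a<..<a + \<delta>} = 0"
    by (subst (asm) AE_iff_null) (auto simp: null_sets_def greaterThanLessThan_def greaterThan_def lessThan_def Collect_conj_eq)
  then show False using \<delta> by simp
qed

section \<open>Hardy's criterion\<close>

text \<open>Write exp (i z x) = exp (i a x) exp (i x (z - a)) and expand the second factor. The
  norms of the terms add up to exp (r |x|) with r < \<epsilon>, so summation and integration
  commute. The radius \<open>\<epsilon>\<close> is the same for every real centre \<open>a\<close>,
  so the discs of convergence fill a horizontal strip.\<close>

lemma (in real_distribution) char_power_series:
  fixes a \<epsilon> :: real and z :: complex
  assumes exp_int: "integrable M (\<lambda>x. exp (\<epsilon> * \<bar>x\<bar>))" and z: "norm (z - a) < \<epsilon>"
  shows "(\<lambda>n. (\<integral>x. (\<i> * of_real x) ^ n /\<^sub>R fact n * exp (\<i> * of_real (a * x)) \<partial>M) * (z - a) ^ n)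
    sums (\<integral>x. exp (\<i> * z * of_real x) \<partial>M)"
proof -
  define r where "r = norm (z - of_real a)"
  have r: "0 \<le> r" "r < \<epsilon>" using z by (auto simp: r_def)
  define f where "f n x = (\<i> * of_real x) ^ n /\<^sub>R fact n * exp (\<i> * of_real (a * x)) * (z - a) ^ n" for n and x :: real
  have [measurable]: "f n \<in> borel_measurable borel" for n unfolding f_def by measurable
  have nf: "norm (f n x) = (r * \<bar>x\<bar>) ^ n /\<^sub>R fact n" for n x
    by (simp add: f_def norm_mult norm_power r_def power_mult_distrib field_simps)
  have nsums: "(\<lambda>n. norm (f n x)) sums exp (r * \<bar>x\<bar>)" for x
    unfolding nf by (rule exp_converges)
  have le: "exp (r * \<bar>x\<bar>) \<le> exp (\<epsilon> * \<bar>x\<bar>)" for x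
    using r by (simp add: mult_right_mono)
  have partial: "(\<Sum>i<n. norm (f i x)) \<le> exp (\<epsilon> * \<bar>x\<bar>)" for n x
    using sum_le_suminf[OF sums_summable[OF nsums[of x]], of "{..<n}"] sums_unique[OF nsums[of x]] le[of x] by auto
  have int: "integrable M (f n)" for n
  proof (rule Bochner_Integration.integrable_bound[OF exp_int])
    show "AE x in M. norm (f n x) \<le> norm (exp (\<epsilon> * \<bar>x\<bar>))"
    proof (rule AE_I2)
      fix x
      have "norm (f n x) \<le> (\<Sum>i<Suc n. norm (f i x))" by (simp add: sum_nonneg)
      also note partial
      finally show "norm (f n x) \<le> norm (exp (\<epsilon> * \<bar>x\<bar>))" by simp
    qed
  qed simp
  have "summable (\<lambda>i. \<integral>x. norm (f i x) \<partial>M)"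
  proof (rule summableI_nonneg_bounded)
    fix n
    have "(\<Sum>i<n. \<integral>x. norm (f i x) \<partial>M) = (\<integral>x. (\<Sum>i<n. norm (f i x)) \<partial>M)"
      using int by simp
    also have "\<dots> \<le> (\<integral>x. exp (\<epsilon> * \<bar>x\<bar>) \<partial>M)"
      using int exp_int partial by (intro integral_mono) auto
    finally show "(\<Sum>i<n. \<integral>x. norm (f i x) \<partial>M) \<le> (\<integral>x. exp (\<epsilon> * \<bar>x\<bar>) \<partial>M)" .
  qed auto
  then have "(\<lambda>n. integral\<^sup>L M (f n)) sums (\<integral>x. (\<Sum>n. f n x) \<partial>M)"
    using int sums_summable[OF nsums] by (intro sums_integral) auto
  moreover have "(\<Sum>n. f n x) = exp (\<i> * z * of_real x)" for x
  proof -
    have "(\<lambda>n. exp (\<i> * of_real (a * x)) * ((\<i> * of_real x * (z - a)) ^ n /\<^sub>R fact n)) sums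
        (exp (\<i> * of_real (a * x)) * exp (\<i> * of_real x * (z - a)))"
      by (intro sums_mult exp_converges)
    also have "(\<lambda>n. exp (\<i> * of_real (a * x)) * ((\<i> * of_real x * (z - a)) ^ n /\<^sub>R fact n)) = (\<lambda>n. f n x)"
      by (simp add: f_def power_mult_distrib scaleR_conv_of_real mult_ac)
    also have "exp (\<i> * of_real (a * x)) * exp (\<i> * of_real x * (z - a)) = exp (\<i> * z * of_real x)"
      by (simp flip: exp_add add: algebra_simps)
    finally show ?thesis by (rule sums_unique[symmetric])
  qed
  moreover have "integral\<^sup>L M (f n) = (\<integral>x. (\<i> * of_real x) ^ n /\<^sub>R fact n * exp (\<i> * of_real (a * x)) \<partial>M) * (z - a) ^ n" for n
    unfolding f_def by (rule integral_mult_left_zero)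
  ultimately show ?thesis by simp
qed

text \<open>Moments are the Taylor coefficients of the characteristic function at 0 and give
  equality only on a disc; analytic continuation through the strip carries it to the whole real
  axis.\<close>

lemma exp_moment_unique:
  fixes \<epsilon> :: real
  assumes M: "real_distribution M" and N: "real_distribution N" and \<epsilon>: "0 < \<epsilon>"
    and intM: "integrable M (\<lambda>x. exp (\<epsilon> * \<bar>x\<bar>))" and intN: "integrable N (\<lambda>x. exp (\<epsilon> * \<bar>x\<bar>))"
    and moments: "\<And>n. (\<integral>x. x ^ n \<partial>M) = (\<integral>x. x ^ n \<partial>N)"
  shows "M = N"
proof (rule Levy_uniqueness[OF M N], rule ext)
  fix t :: real
  define F where "F M z = (\<integral>x. exp (\<i> * z * of_real x) \<partial>M)" for M :: "real measure" and z
  \<comment> \<open>Since the inner product of \<open>z\<close> with \<open>\<i>\<close> is the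
    imaginary part, this is the strip |Im z| < \<epsilon>. As a linear preimage of an interval it is
    visibly convex and open.\<close>
  define S where "S = (\<lambda>z. z \<bullet> \<i>) -` {-\<epsilon><..<\<epsilon>}"
  have hol: "F M holomorphic_on S" if "real_distribution M" "integrable M (\<lambda>x. exp (\<epsilon> * \<bar>x\<bar>))" for M
  proof (rule holomorphic_on_subset)
    interpret real_distribution M by fact
    have "F M holomorphic_on ball (of_real a) \<epsilon>" for a :: real
      by (rule power_series_holomorphic[OF char_power_series[OF that(2), of _ a, folded F_def]]) (simp add: dist_norm norm_minus_commute)
    then show "F M holomorphic_on (\<Union>a\<in>range complex_of_real. ball a \<epsilon>)"
      by (intro holomorphic_on_UN_open) auto
    show "S \<subseteq> (\<Union>a\<in>range complex_of_real. ball a \<epsilon>)"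
    proof
      fix z assume "z \<in> S"
      then have "norm (of_real (Re z) - z) < \<epsilon>"
        by (simp add: S_def inner_complex_def cmod_def abs_less_iff)
      then show "z \<in> (\<Union>a\<in>range complex_of_real. ball a \<epsilon>)" by (auto simp: dist_norm)
    qed
  qed
  have "F M z = F N z" if z: "z \<in> ball 0 \<epsilon>" for z
  proof -
    interpret M: real_distribution M by fact
    interpret N: real_distribution N by fact
    have eq: "(\<integral>x. (\<i> * of_real x) ^ n /\<^sub>R fact n * exp (\<i> * of_real (0 * x)) \<partial>M)
      = (\<i> ^ n / fact n) * of_real (\<integral>x. x ^ n \<partial>M)" for M n
    proof -
      have "(\<integral>x. (\<i> * of_real x) ^ n /\<^sub>R fact n * exp (\<i> * of_real (0 * x)) \<partial>M) = (\<integral>x. (\<i> ^ n / fact n) * complex_of_real (x ^ n) \<partial>M)"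
        by (intro Bochner_Integration.integral_cong) (auto simp: power_mult_distrib scaleR_conv_of_real field_simps)
      then show ?thesis by (simp del: of_real_power)
    qed
    have zz: "norm (z - of_real 0) < \<epsilon>" using z by simp
    show ?thesis
      using sums_unique2[OF M.char_power_series[OF intM zz, unfolded eq moments] N.char_power_series[OF intN zz, unfolded eq]]
      by (simp add: F_def)
  qed
  then have eq: "\<And>z. z \<in> ball 0 \<epsilon> \<Longrightarrow> F M z = F N z" .
  have t: "of_real t \<in> S" using \<epsilon> by (simp add: S_def inner_complex_def)
  have conn: "connected S"
    unfolding S_def by (intro convex_connected convex_linear_vimage bounded_linear.linear bounded_linear_inner_left convex_real_interval)
  have opn: "open S" unfolding S_def by (intro open_vimage continuous_intros open_greaterThanLessThan)
  have sub: "ball 0 \<epsilon> \<subseteq> S"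
  proof
    fix z :: complex assume "z \<in> ball 0 \<epsilon>"
    then show "z \<in> S" using abs_Im_le_cmod[of z] by (simp add: S_def inner_complex_def abs_le_iff)
  qed
  have "F M (of_real t) = F N (of_real t)"
    by (rule analytic_continuation_open[OF open_ball opn _ conn sub hol[OF M intM] hol[OF N intN] eq t])
       (use \<epsilon> in auto)
  then show "char M t = char N t" by (simp add: F_def char_def mult_ac)
qed

text \<open>The law of a square root with an independent fair sign. Without the sign, odd moments
  would be half-integer moments of \<open>M\<close>, which the data do not control; with it they
  vanish, and uniqueness on the half-line becomes uniqueness on the line.\<close>

definition symm_sqrt :: "real measure \<Rightarrow> real measure" where
  "symm_sqrt M = distr (M \<Otimes>\<^sub>M measure_pmf (bernoulli_pmf (1/2))) borel (\<lambda>(y, b). if b then sqrt y else - sqrt y)"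

lemma symm_sqrt:
  assumes "prob_space M" and sets[measurable_cong]: "sets M = sets borel"
  shows "real_distribution (symm_sqrt M)"
    and "\<And>g :: real \<Rightarrow> real. g \<in> borel_measurable borel \<Longrightarrow> integrable M (\<lambda>y. g (sqrt y)) \<Longrightarrow> integrable M (\<lambda>y. g (- sqrt y)) \<Longrightarrow>
      integrable (symm_sqrt M) g \<and> (\<integral>x. g x \<partial>symm_sqrt M) = (\<integral>y. (g (sqrt y) + g (- sqrt y)) / 2 \<partial>M)"
    and "AE y in M. 0 \<le> y \<Longrightarrow> distr (symm_sqrt M) borel (\<lambda>x. x\<^sup>2) = M"
proof -
  interpret M: prob_space M by fact
  let ?B = "measure_pmf (bernoulli_pmf (1/2))"
  interpret MB: pair_prob_space M ?B ..
  have m[measurable]: "(\<lambda>(y, b). if b then sqrt y else - sqrt y) \<in> borel_measurable (M \<Otimes>\<^sub>M ?B)"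
    by measurable
  show "real_distribution (symm_sqrt M)"
    unfolding symm_sqrt_def by (intro real_distribution.intro MB.P.prob_space_distr real_distribution_axioms.intro) auto
  show "integrable (symm_sqrt M) g \<and> (\<integral>x. g x \<partial>symm_sqrt M) = (\<integral>y. (g (sqrt y) + g (- sqrt y)) / 2 \<partial>M)"
    if [measurable]: "g \<in> borel_measurable borel" and int: "integrable M (\<lambda>y. g (sqrt y))" "integrable M (\<lambda>y. g (- sqrt y))"
    for g :: "real \<Rightarrow> real"
  proof -
    let ?h = "\<lambda>(y, b). g (if b then sqrt y else - sqrt y)"
    have h: "(\<lambda>x. g ((\<lambda>(y, b). if b then sqrt y else - sqrt y) x)) = ?h" by auto
    have "integrable (M \<Otimes>\<^sub>M ?B) ?h"
    proof (rule integrableI_bounded)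
      have "(\<integral>\<^sup>+x. ennreal (norm (?h x)) \<partial>(M \<Otimes>\<^sub>M ?B)) = (\<integral>\<^sup>+y. \<integral>\<^sup>+b. ennreal (norm (?h (y, b))) \<partial>?B \<partial>M)"
        by (subst measure_pmf.nn_integral_fst[symmetric]) auto
      also have "\<dots> \<le> (\<integral>\<^sup>+y. ennreal (norm (g (sqrt y)) + norm (g (- sqrt y))) \<partial>M)"
      proof (intro nn_integral_mono)
        fix y
        have "(\<integral>\<^sup>+b. ennreal (norm (?h (y, b))) \<partial>?B) \<le> (\<integral>\<^sup>+b. ennreal (norm (g (sqrt y)) + norm (g (- sqrt y))) \<partial>?B)"
          by (intro nn_integral_mono) auto
        then show "(\<integral>\<^sup>+b. ennreal (norm (?h (y, b))) \<partial>?B) \<le> ennreal (norm (g (sqrt y)) + norm (g (- sqrt y)))"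
          by (simp add: measure_pmf.emeasure_space_1[simplified])
      qed
      also have "\<dots> < \<infinity>"
        using Bochner_Integration.integrable_add[OF integrable_norm[OF int(1)] integrable_norm[OF int(2)]]
        by (subst (asm) integrable_iff_bounded) (simp add: abs_of_nonneg)
      finally show "(\<integral>\<^sup>+x. ennreal (norm (?h x)) \<partial>(M \<Otimes>\<^sub>M ?B)) < \<infinity>" .
    qed measurable
    moreover from MB.integral_fst'[OF this]
    have "(\<integral>x. ?h x \<partial>(M \<Otimes>\<^sub>M ?B)) = (\<integral>y. (g (sqrt y) + g (- sqrt y)) / 2 \<partial>M)"
      by (simp add: add_divide_distrib)
    ultimately show ?thesis
      unfolding symm_sqrt_def by (simp add: integrable_distr_eq integral_distr h)
  qed
  assume nn: "AE y in M. 0 \<le> y"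
  have "distr (symm_sqrt M) borel (\<lambda>x. x\<^sup>2) = distr (M \<Otimes>\<^sub>M ?B) borel ((\<lambda>x. x\<^sup>2) \<circ> (\<lambda>(y, b). if b then sqrt y else - sqrt y))"
    unfolding symm_sqrt_def by (subst distr_distr) auto
  \<comment> \<open>Here \<open>sqrt\<close> is an odd function on the reals, so the square is the
    absolute value of \<open>y\<close> for every real \<open>y\<close>; nonnegativity is invoked
    only when the absolute value is removed.\<close>
  also have "\<dots> = distr (M \<Otimes>\<^sub>M ?B) borel (\<lambda>x. \<bar>fst x\<bar>)"
    by (intro distr_cong) (auto simp: power2_eq_square)
  also have "\<dots> = distr (distr (M \<Otimes>\<^sub>M ?B) M fst) borel (\<lambda>y. \<bar>y\<bar>)"
    by (subst distr_distr) (auto simp: o_def)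
  also have "\<dots> = distr M borel (\<lambda>y. \<bar>y\<bar>)"
    by (subst measure_pmf.distr_pair_fst) auto
  also have "\<dots> = distr M borel (\<lambda>y. y)"
    using nn by (intro distr_cong_AE) auto
  also have "\<dots> = M" by (rule distr_id2) (simp add: sets)
  finally show "distr (symm_sqrt M) borel (\<lambda>x. x\<^sup>2) = M" .
qed

text \<open>Of a competing law only the integer moments are known. They suffice because cosh
  (\<delta> sqrt y) is a power series in \<open>y\<close> itself; the moment bound makes the
  expected terms geometric with ratio (\<delta>/\<epsilon>)^2, and exp <= 2 cosh.\<close>

lemma integrable_exp_sqrt_of_moments:
  assumes "prob_space M" and sets: "sets M = sets borel" and nn: "AE y in M. 0 \<le> y" and \<epsilon>: "0 < \<epsilon>"
    and int: "\<And>n. integrable M (\<lambda>y. y ^ n)"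
    and bound: "\<And>n. (\<integral>y. y ^ n \<partial>M) \<le> A * fact (2 * n) / \<epsilon> ^ (2 * n)"
    and \<delta>: "0 < \<delta>" "\<delta> < \<epsilon>"
  shows "integrable M (\<lambda>y. exp (\<delta> * sqrt y))"
proof -
  interpret prob_space M by fact
  have [measurable]: "(\<lambda>y. y) \<in> borel_measurable M" by (simp add: measurable_ident_sets sets)
  define f where "f n y = (\<delta> ^ 2 * y) ^ n /\<^sub>R fact (2 * n)" for n and y :: real
  have cosh: "(\<lambda>n. f n y) sums cosh (\<delta> * sqrt y)" if "0 \<le> y" for y
  proof -
    have "(\<lambda>n. if even n then (\<delta> * sqrt y) ^ n /\<^sub>R fact n else 0) sums cosh (\<delta> * sqrt y)"
      by (rule cosh_converges)
    then have "(\<lambda>n. (\<delta> * sqrt y) ^ (2 * n) /\<^sub>R fact (2 * n)) sums cosh (\<delta> * sqrt y)"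
      by (subst (asm) sums_mono_reindex[of "\<lambda>n. 2 * n", symmetric]) (auto simp: strict_mono_def elim!: evenE)
    moreover have "(\<delta> * sqrt y) ^ (2 * n) = (\<delta> ^ 2 * y) ^ n" for n
      using that by (simp add: power_mult power_mult_distrib)
    ultimately show ?thesis by (simp add: f_def)
  qed
  have int_f: "integrable M (f n)" for n
    unfolding f_def using int[of n] by (simp add: power_mult_distrib)
  have f_nn: "0 \<le> f n y" if "0 \<le> y" for n y using that by (simp add: f_def)
  have If: "(\<integral>y. norm (f n y) \<partial>M) = \<delta> ^ (2 * n) / fact (2 * n) * (\<integral>y. y ^ n \<partial>M)" for n
  proof -
    have "(\<integral>y. norm (f n y) \<partial>M) = (\<integral>y. \<delta> ^ (2 * n) / fact (2 * n) * y ^ n \<partial>M)"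
      using nn \<delta> by (intro integral_cong_AE) (auto elim!: eventually_mono simp: f_def abs_mult power_abs power_mult_distrib field_simps simp flip: power_mult)
    then show ?thesis by simp
  qed
  have "summable (\<lambda>n. \<integral>y. norm (f n y) \<partial>M)"
  proof (rule summable_comparison_test')
    show "summable (\<lambda>n. A * ((\<delta> / \<epsilon>) ^ 2) ^ n)"
      using \<epsilon> \<delta> by (intro summable_mult summable_geometric) (simp add: power2_eq_square divide_simps mult_strict_mono)
    show "norm (\<integral>y. norm (f n y) \<partial>M) \<le> A * ((\<delta> / \<epsilon>) ^ 2) ^ n" for n
    proof -
      have "norm (\<integral>y. norm (f n y) \<partial>M) = (\<integral>y. norm (f n y) \<partial>M)" by simp
      also have "\<dots> \<le> \<delta> ^ (2 * n) / fact (2 * n) * (A * fact (2 * n) / \<epsilon> ^ (2 * n))"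
        unfolding If using \<delta> by (intro mult_left_mono bound) auto
      also have "\<dots> = A * ((\<delta> / \<epsilon>) ^ 2) ^ n"
        by (simp add: power_mult power_divide)
      finally show ?thesis .
    qed
  qed
  then have *: "integrable M (\<lambda>y. \<Sum>n. f n y)"
    using nn int_f by (intro integrable_suminf) (auto elim!: eventually_mono simp: abs_of_nonneg f_nn intro: sums_summable[OF cosh])
  show ?thesis
  proof (rule Bochner_Integration.integrable_bound)
    show "integrable M (\<lambda>y. 2 * (\<Sum>n. f n y))" using * by simp
    show "AE y in M. norm (exp (\<delta> * sqrt y)) \<le> norm (2 * (\<Sum>n. f n y))"
      using nn by eventually_elim (simp add: sums_unique[OF cosh, symmetric] cosh_def)
  qed simp
qed

text \<open>Exponential integrability is a property of one law, whereas competitors share only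
  moments. It is therefore encoded as a bound on the growth of moments, passed to the competitor,
  and converted back there; then the symmetrised square roots can be compared and squared.\<close>

lemma M_det_of_exp_sqrt:
  assumes "prob_space M" and Y[measurable]: "Y \<in> borel_measurable M" and nn: "AE x in M. 0 \<le> Y x"
    and \<epsilon>: "0 < \<epsilon>" and int: "integrable M (\<lambda>x. exp (\<epsilon> * sqrt (Y x)))"
  shows "M_det M Y"
proof -
  interpret prob_space M by fact
  define A where "A = (\<integral>x. exp (\<epsilon> * sqrt (Y x)) \<partial>M)"
  \<comment> \<open>A single term of the exponential series, the one of order
    \<open>2 * n\<close>.\<close>
  have pow_le: "y ^ n \<le> fact (2 * n) / \<epsilon> ^ (2 * n) * exp (\<epsilon> * sqrt y)" if "0 \<le> y" for y n
  proof -
    have "(\<epsilon> * sqrt y) ^ (2 * n) /\<^sub>R fact (2 * n) \<le> exp (\<epsilon> * sqrt y)"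
      using \<epsilon> that sum_le_suminf[OF summable_exp_generic[of "\<epsilon> * sqrt y"], of "{2 * n}"] by (simp add: exp_def)
    moreover have "(\<epsilon> * sqrt y) ^ (2 * n) = \<epsilon> ^ (2 * n) * y ^ n"
      using that by (simp add: power_mult power_mult_distrib)
    ultimately show ?thesis using \<epsilon> by (simp add: field_simps)
  qed
  have intY: "integrable M (\<lambda>x. Y x ^ n)" for n
    by (rule Bochner_Integration.integrable_bound[OF integrable_mult_right[OF int, of "fact (2 * n) / \<epsilon> ^ (2 * n)"]])
       (use nn pow_le \<epsilon> in \<open>auto elim!: eventually_mono simp: abs_mult\<close>)
  have bound: "(\<integral>x. Y x ^ n \<partial>M) \<le> A * fact (2 * n) / \<epsilon> ^ (2 * n)" for n
  proof -
    have "(\<integral>x. Y x ^ n \<partial>M) \<le> (\<integral>x. fact (2 * n) / \<epsilon> ^ (2 * n) * exp (\<epsilon> * sqrt (Y x)) \<partial>M)"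
      using nn pow_le by (intro integral_mono_AE intY integrable_mult_right int) (auto elim!: eventually_mono)
    then show ?thesis by (simp add: A_def mult_ac)
  qed
  define \<mu> where "\<mu> = distr M borel Y"
  have "prob_space \<mu>" "sets \<mu> = sets borel" "AE y in \<mu>. 0 \<le> y"
    unfolding \<mu>_def using nn by (auto intro: prob_space_distr simp: AE_distr_iff)
  moreover have int\<mu>: "integrable \<mu> (\<lambda>y. y ^ n)" and mom\<mu>: "(\<integral>y. y ^ n \<partial>\<mu>) = (\<integral>x. Y x ^ n \<partial>M)" for n
    unfolding \<mu>_def using intY[of n] by (simp_all add: integrable_distr_eq integral_distr)
  ultimately have \<mu>: "prob_space \<mu>" "sets \<mu> = sets borel" "AE y in \<mu>. 0 \<le> y" "\<And>n. integrable \<mu> (\<lambda>y. y ^ n)" by auto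
  have "\<nu> = \<mu>" if \<nu>: "prob_space \<nu>" "sets \<nu> = sets borel" "AE x in \<nu>. 0 \<le> x"
     and m: "\<And>n. 1 \<le> n \<Longrightarrow> integrable \<nu> (\<lambda>x. x ^ n) \<and> (\<integral>x. x ^ n \<partial>\<nu>) = (\<integral>\<omega>. Y \<omega> ^ n \<partial>M)" for \<nu>
  proof -
    interpret \<nu>: prob_space \<nu> by fact
    \<comment> \<open>The hypothesis starts at order 1; order 0 is supplied by both measures being
      probabilities.\<close>
    have int\<nu>: "integrable \<nu> (\<lambda>y. y ^ n)" and mom\<nu>: "(\<integral>y. y ^ n \<partial>\<nu>) = (\<integral>x. Y x ^ n \<partial>M)" for n
      using m[of n] by (cases n; simp add: prob_space \<nu>.prob_space)+
    \<comment> \<open>Any \<open>\<delta>\<close> strictly below \<open>\<epsilon>\<close> would do;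
      strictness is what makes the geometric series converge.\<close>
    define \<delta> where "\<delta> = \<epsilon> / 2"
    have \<delta>: "0 < \<delta>" "\<delta> < \<epsilon>" using \<epsilon> by (auto simp: \<delta>_def)
    have ex: "integrable N (\<lambda>y. exp (\<delta> * sqrt y))"
      if "prob_space N" "sets N = sets borel" "AE y in N. 0 \<le> y" "\<And>n. integrable N (\<lambda>y. y ^ n)"
        "\<And>n. (\<integral>y. y ^ n \<partial>N) = (\<integral>x. Y x ^ n \<partial>M)" for N
      by (rule integrable_exp_sqrt_of_moments[OF that(1-3) \<epsilon> that(4) _ \<delta>]) (use bound that(5) in simp)
    have exs: "integrable (symm_sqrt N) (\<lambda>x. exp (\<delta> * \<bar>x\<bar>))"
      if "prob_space N" "sets N = sets borel" "AE y in N. 0 \<le> y" "integrable N (\<lambda>y. exp (\<delta> * sqrt y))" for N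
    proof -
      have [measurable]: "(\<lambda>y. y) \<in> borel_measurable N" by (simp add: measurable_ident_sets that)
      have "integrable N (\<lambda>y. exp (\<delta> * \<bar>sqrt y\<bar>))"
      proof (rule Bochner_Integration.integrable_bound[OF that(4)])
        show "AE y in N. norm (exp (\<delta> * \<bar>sqrt y\<bar>)) \<le> norm (exp (\<delta> * sqrt y))"
          using that(3) by eventually_elim simp
      qed simp
      then show ?thesis using symm_sqrt(2)[OF that(1,2), of "\<lambda>x. exp (\<delta> * \<bar>x\<bar>)"] by simp
    qed
    have sm: "(\<integral>x. x ^ n \<partial>symm_sqrt N) = (if even n then (\<integral>y. y ^ (n div 2) \<partial>N) else 0)"
      if N: "prob_space N" "sets N = sets borel" "AE y in N. 0 \<le> y" "integrable N (\<lambda>y. exp (\<delta> * sqrt y))" for N n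
    proof -
      have [measurable]: "(\<lambda>y. y) \<in> borel_measurable N" by (simp add: measurable_ident_sets that)
      have le: "\<bar>sqrt y ^ n\<bar> \<le> fact n / \<delta> ^ n * exp (\<delta> * sqrt y)" if "0 \<le> y" for y
      proof -
        have "(\<delta> * sqrt y) ^ n /\<^sub>R fact n \<le> exp (\<delta> * sqrt y)"
          using \<delta> that sum_le_suminf[OF summable_exp_generic[of "\<delta> * sqrt y"], of "{n}"] by (simp add: exp_def)
        then show ?thesis using \<delta> that by (simp add: field_simps power_mult_distrib)
      qed
      have "integrable N (\<lambda>y. sqrt y ^ n)"
        by (rule Bochner_Integration.integrable_bound[OF integrable_mult_right[OF N(4), of "fact n / \<delta> ^ n"]])
          (use N(3) le \<delta> in \<open>auto elim!: eventually_mono simp: abs_mult\<close>)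
      moreover from this have "integrable N (\<lambda>y. (- sqrt y) ^ n)"
        by (cases "even n") auto
      ultimately have "(\<integral>x. x ^ n \<partial>symm_sqrt N) = (\<integral>y. (sqrt y ^ n + (- sqrt y) ^ n) / 2 \<partial>N)"
        using symm_sqrt(2)[OF N(1,2), of "\<lambda>x. x ^ n"] by simp
      also have "\<dots> = (if even n then (\<integral>y. y ^ (n div 2) \<partial>N) else 0)"
      proof (cases "even n")
        case True
        then obtain k where k: "n = 2 * k" by (elim evenE)
        show ?thesis unfolding k using N(3)
          by simp (intro integral_cong_AE; auto elim!: eventually_mono simp: power_mult)
      qed simp
      finally show ?thesis .
    qed
    note ex\<nu> = ex[OF \<nu> int\<nu> mom\<nu>] and ex\<mu> = ex[OF \<mu> mom\<mu>]
    have "symm_sqrt \<nu> = symm_sqrt \<mu>"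
    proof (rule exp_moment_unique[OF symm_sqrt(1)[OF \<nu>(1,2)] symm_sqrt(1)[OF \<mu>(1,2)] \<delta>(1)
        exs[OF \<nu> ex\<nu>] exs[OF \<mu>(1-3) ex\<mu>]])
      show "(\<integral>x. x ^ n \<partial>symm_sqrt \<nu>) = (\<integral>x. x ^ n \<partial>symm_sqrt \<mu>)" for n
        by (simp only: sm[OF \<nu> ex\<nu>] sm[OF \<mu>(1-3) ex\<mu>] mom\<nu> mom\<mu>)
    qed
    then have "distr (symm_sqrt \<nu>) borel (\<lambda>x. x\<^sup>2) = distr (symm_sqrt \<mu>) borel (\<lambda>x. x\<^sup>2)" by (rule arg_cong)
    then show "\<nu> = \<mu>" unfolding symm_sqrt(3)[OF \<nu>(1,2,3)] symm_sqrt(3)[OF \<mu>(1,2,3)] .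
  qed
  note unique = this
  show ?thesis unfolding M_det_def
  proof (intro conjI allI impI)
    fix \<nu> :: "real measure"
    assume H: "prob_space \<nu> \<and> sets \<nu> = sets borel \<and> (AE x in \<nu>. 0 \<le> x) \<and>
        (\<forall>n\<ge>1. integrable \<nu> (\<lambda>x. x ^ n) \<and> (\<integral>x. x ^ n \<partial>\<nu>) = (\<integral>\<omega>. Y \<omega> ^ n \<partial>M))"
    have "\<nu> = \<mu>" by (rule unique) (simp_all only: H)
    then show "\<nu> = distr M borel Y" by (simp only: \<mu>_def)
  qed (rule intY)
qed

section \<open>Powers, tails and hazard rates\<close>

text \<open>A bridge between two notions of integral: densities are handled by nonnegative integrals
  over \<open>lborel\<close>, the change of variables below by absolutely integrable functions on a
  set.\<close>

lemma nn_integral_eq_HK_integral: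
  fixes q :: "real \<Rightarrow> real"
  assumes [measurable]: "q \<in> borel_measurable borel" "S \<in> sets borel" and nn: "\<And>x. 0 \<le> q x"
    and int: "q absolutely_integrable_on S"
  shows "(\<integral>\<^sup>+x. ennreal (q x) * indicator S x \<partial>lborel) = ennreal (integral S q)"
proof -
  have "integrable lebesgue (\<lambda>x. indicator S x *\<^sub>R q x)" using int by (simp add: set_integrable_def)
  then have i: "integrable lborel (\<lambda>x. indicator S x *\<^sub>R q x)"
    by (subst (asm) integrable_completion) auto
  have "(\<integral>\<^sup>+x. ennreal (q x) * indicator S x \<partial>lborel) = (\<integral>\<^sup>+x. ennreal (indicator S x *\<^sub>R q x) \<partial>lborel)"
    by (intro nn_integral_cong) (auto split: split_indicator)
  also have "\<dots> = ennreal (\<integral>x. indicator S x *\<^sub>R q x \<partial>lborel)"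
    using i nn by (intro nn_integral_eq_integral) auto
  also have "(\<integral>x. indicator S x *\<^sub>R q x \<partial>lborel) = integral S q"
    using set_borel_integral_eq_integral(2)[of S q] i by (simp add: set_integrable_def set_lebesgue_integral_def)
  finally show ?thesis .
qed

text \<open>Substitution along the inverse map \<open>y powr (1 / t)\<close>. The absolute value of
  its derivative treats increasing and decreasing powers together.\<close>

lemma has_pos_density_powr:
  assumes d: "has_pos_density M X h" and t: "t \<noteq> 0"
  shows "has_pos_density M (\<lambda>\<omega>. X \<omega> powr t) (\<lambda>y. h (y powr (1 / t)) * y powr (1 / t - 1) / \<bar>t\<bar>)"
proof -
  define p where "p y = h y * indicator {0<..} y" for y :: real
  note F = has_pos_density_facts[OF d, folded p_def]
  note [measurable] = F(1,4)
  define q where "q y = \<bar>1 / t * y powr (1 / t - 1)\<bar> * p (y powr (1 / t))" for y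
  define q' where "q' y = q y * indicator {0<..} y" for y
  have q_eq: "h (y powr (1 / t)) * y powr (1 / t - 1) / \<bar>t\<bar> * indicator {0<..} y = q' y" for y
    using t by (auto simp: q'_def q_def p_def abs_mult split: split_indicator)
  have [measurable]: "q \<in> borel_measurable borel" unfolding q_def by measurable
  have [measurable]: "q' \<in> borel_measurable borel" unfolding q'_def by measurable
  have q0: "0 \<le> q y" for y using F(2) by (simp add: q_def)
  have "distr M lborel (\<lambda>\<omega>. X \<omega> powr t) = density lborel (\<lambda>y. ennreal (q' y))"
  proof (rule measure_eqI)
    fix A assume "A \<in> sets (distr M lborel (\<lambda>\<omega>. X \<omega> powr t))"
    then have [measurable]: "A \<in> sets borel" by simp
    \<comment> \<open>Both sets are restricted to positive reals, where the power map is a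
      bijection; the densities vanish elsewhere.\<close>
    define S where "S = A \<inter> {0<..}"
    define T where "T = {x. 0 < x \<and> x powr t \<in> A}"
    have [measurable]: "S \<in> sets borel" "T \<in> sets borel" unfolding S_def T_def by measurable
    have img: "(\<lambda>y. y powr (1 / t)) ` S = T"
    proof (intro equalityI subsetI)
      fix x assume "x \<in> T"
      then show "x \<in> (\<lambda>y. y powr (1 / t)) ` S"
        using t by (intro image_eqI[of _ _ "x powr t"]) (auto simp: T_def S_def powr_powr)
    qed (use t in \<open>auto simp: T_def S_def powr_powr\<close>)
    have pT: "p absolutely_integrable_on T"
      unfolding set_integrable_def
      by (intro integrable_mult_indicator) (use F(7) in \<open>auto simp: integrable_completion\<close>)
    have "(\<lambda>y. \<bar>1 / t * y powr (1 / t - 1)\<bar> * p (y powr (1 / t))) absolutely_integrable_on S \<and>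
        integral S (\<lambda>y. \<bar>1 / t * y powr (1 / t - 1)\<bar> * p (y powr (1 / t))) = integral T p \<longleftrightarrow>
      p absolutely_integrable_on (\<lambda>y. y powr (1 / t)) ` S \<and> integral ((\<lambda>y. y powr (1 / t)) ` S) p = integral T p"
    proof (rule has_absolute_integral_change_of_variables_1')
      show "S \<in> sets lebesgue" using \<open>S \<in> sets borel\<close> by auto
      show "inj_on (\<lambda>y. y powr (1 / t)) S"
        by (rule inj_on_inverseI[where g = "\<lambda>y. y powr t"]) (use t in \<open>simp add: S_def powr_powr\<close>)
      show "((\<lambda>y. y powr (1 / t)) has_real_derivative 1 / t * x powr (1 / t - 1)) (at x within S)" if "x \<in> S" for x
        using that by (intro DERIV_subset[OF has_real_derivative_powr]) (auto simp: S_def)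
    qed
    with pT have "q absolutely_integrable_on S \<and> integral S q = integral T p"
      unfolding img q_def[symmetric] by simp
    then have "(\<integral>\<^sup>+x. ennreal (q x) * indicator S x \<partial>lborel) = (\<integral>\<^sup>+x. ennreal (p x) * indicator T x \<partial>lborel)"
      using pT by (simp add: nn_integral_eq_HK_integral q0 F(2))
    moreover have "emeasure (density lborel (\<lambda>y. ennreal (q' y))) A = (\<integral>\<^sup>+x. ennreal (q x) * indicator S x \<partial>lborel)"
      by (subst emeasure_density) (auto simp: q'_def S_def intro!: nn_integral_cong split: split_indicator)
    moreover have "emeasure (distr M lborel (\<lambda>\<omega>. X \<omega> powr t)) A = (\<integral>\<^sup>+x. ennreal (p x) * indicator T x \<partial>lborel)"
    proof -
      have "emeasure (distr M lborel (\<lambda>\<omega>. X \<omega> powr t)) A = emeasure (distr M borel X) {x. x powr t \<in> A}"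
        by (simp add: emeasure_distr) (simp add: vimage_def)
      also have "\<dots> = (\<integral>\<^sup>+x. ennreal (p x) * indicator T x \<partial>lborel)"
      proof -
        have "emeasure (density lborel (\<lambda>y. ennreal (p y))) {x. x powr t \<in> A} =
            (\<integral>\<^sup>+x. ennreal (p x) * indicator {x. x powr t \<in> A} x \<partial>lborel)"
          by (rule emeasure_density) auto
        also have "\<dots> = (\<integral>\<^sup>+x. ennreal (p x) * indicator T x \<partial>lborel)"
          by (intro nn_integral_cong) (auto simp: p_def T_def split: split_indicator)
        finally show ?thesis unfolding F(3) .
      qed
      finally show ?thesis .
    qed
    ultimately show "emeasure (distr M lborel (\<lambda>\<omega>. X \<omega> powr t)) A = emeasure (density lborel (\<lambda>y. ennreal (q' y))) A"
      by simp
  qed simp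
  then show ?thesis
    unfolding has_pos_density_def distributed_def q_eq using F(5,6) by simp
qed

section \<open>Tails and the consequences of hazard-rate bounds\<close>

definition tail :: "'a measure \<Rightarrow> ('a \<Rightarrow> real) \<Rightarrow> real \<Rightarrow> real" where
  "tail M X x = measure (distr M borel X) {x<..}"

context
  fixes M :: "'a measure" and X :: "'a \<Rightarrow> real" and h :: "real \<Rightarrow> real"
  assumes d: "has_pos_density M X h"
begin

lemma tail_props: "x \<le> y \<Longrightarrow> tail M X y \<le> tail M X x" "0 \<le> tail M X x" "tail M X x \<le> 1" "tail M X 0 = 1"
  "(tail M X \<longlongrightarrow> 0) at_top"
proof -
  note F = has_pos_density_facts[OF d]
  note [measurable] = F(4)
  interpret prob_space M by (rule F(5))
  interpret D: prob_space "distr M borel X" by (rule prob_space_distr) simp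
  interpret R: real_distribution "distr M borel X" by unfold_locales simp
  show "x \<le> y \<Longrightarrow> tail M X y \<le> tail M X x" unfolding tail_def by (intro D.finite_measure_mono) auto
  show "0 \<le> tail M X x" "tail M X x \<le> 1" unfolding tail_def by auto
  show "tail M X 0 = 1" unfolding tail_def
    using F(9) by (subst D.prob_eq_1) (auto simp: AE_distr_iff)
  have "tail M X = (\<lambda>x. 1 - cdf (distr M borel X) x)"
  proof
    fix x
    have "{x<..} = space (distr M borel X) - {..x}" by auto
    then show "tail M X x = 1 - cdf (distr M borel X) x"
      unfolding tail_def cdf_def by (simp only:, subst D.prob_compl) auto
  qed
  then show "(tail M X \<longlongrightarrow> 0) at_top"
    using tendsto_diff[OF tendsto_const[of 1] R.cdf_lim_at_top_prob] by simp
qed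

lemma tail_diff_eq:
  assumes "0 \<le> x" "x \<le> y"
  shows "ennreal (tail M X x - tail M X y) = (\<integral>\<^sup>+u. ennreal (h u) * indicator {x<..y} u \<partial>lborel)"
proof -
  note F = has_pos_density_facts[OF d]
  note [measurable] = F(1,4)
  interpret prob_space M by (rule F(5))
  interpret D: prob_space "distr M borel X" by (rule prob_space_distr) simp
  have "measure (distr M borel X) ({x<..y} \<union> {y<..}) = measure (distr M borel X) {x<..y} + tail M X y"
    unfolding tail_def by (rule D.finite_measure_Union) auto
  moreover have "{x<..y} \<union> {y<..} = {x<..}" using assms by auto
  ultimately have "tail M X x = measure (distr M borel X) {x<..y} + tail M X y"
    by (simp only: tail_def)
  then have "ennreal (tail M X x - tail M X y) = emeasure (distr M borel X) {x<..y}"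
    by (simp add: D.emeasure_eq_measure)
  also have "\<dots> = (\<integral>\<^sup>+u. ennreal (h u) * indicator {x<..y} u \<partial>lborel)"
    unfolding F(3) using assms by (subst emeasure_density) (auto intro!: nn_integral_cong split: split_indicator)
  finally show ?thesis .
qed

lemma tail_diff_le:
  assumes "0 \<le> x" "x \<le> y" "0 \<le> B" "\<And>u. x < u \<Longrightarrow> u \<le> y \<Longrightarrow> h u \<le> B"
  shows "tail M X x - tail M X y \<le> B * (y - x)"
proof -
  have "ennreal (tail M X x - tail M X y) \<le> (\<integral>\<^sup>+u. ennreal B * indicator {x<..y} u \<partial>lborel)"
    unfolding tail_diff_eq[OF assms(1,2)] using assms
    by (intro nn_integral_mono) (auto simp: ennreal_leI split: split_indicator)
  also have "\<dots> = ennreal (B * (y - x))"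
    using assms by (simp add: nn_integral_cmult_indicator ennreal_mult)
  finally show ?thesis using assms by (simp add: ennreal_le_iff)
qed

lemma tail_diff_ge:
  assumes "0 \<le> x" "x \<le> y" "0 \<le> B" "\<And>u. x < u \<Longrightarrow> u \<le> y \<Longrightarrow> B \<le> h u"
  shows "B * (y - x) \<le> tail M X x - tail M X y"
proof -
  have "ennreal (B * (y - x)) = (\<integral>\<^sup>+u. ennreal B * indicator {x<..y} u \<partial>lborel)"
    using assms by (simp add: nn_integral_cmult_indicator ennreal_mult)
  also have "\<dots> \<le> ennreal (tail M X x - tail M X y)"
    unfolding tail_diff_eq[OF assms(1,2)] using assms
    by (intro nn_integral_mono) (auto simp: ennreal_leI split: split_indicator)
  finally show ?thesis using assms tail_props(1)[of x y] by (simp add: ennreal_le_iff)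
qed

text \<open>A discrete Gronwall argument: on a step of length 1/(2b) the density is at most
  \<open>b\<close> times the tail at the start, so at most half of the tail is lost. The rate
  \<open>2 * b\<close> is not sharp, but only the exponential order matters.\<close>

lemma tail_ge_exp:
  assumes b: "0 < b" and haz: "\<And>z. 0 < z \<Longrightarrow> h z \<le> b * tail M X z" and z: "0 \<le> z"
  shows "exp (- 2 * b * z) / 2 \<le> tail M X z"
proof -
  define \<delta> where "\<delta> = 1 / (2 * b)"
  have \<delta>: "0 < \<delta>" "b * \<delta> = 1 / 2" using b by (auto simp: \<delta>_def)
  have step: "tail M X z / 2 \<le> tail M X (z + \<delta>)" if "0 \<le> z" for z
  proof -
    have "h u \<le> b * tail M X z" if "z < u" for u
    proof -
      have "h u \<le> b * tail M X u" using haz that \<open>0 \<le> z\<close> by simp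
      also have "\<dots> \<le> b * tail M X z" using tail_props(1)[of z u] that b by simp
      finally show ?thesis .
    qed
    then have "tail M X z - tail M X (z + \<delta>) \<le> b * tail M X z * (z + \<delta> - z)"
      using that b \<delta> tail_props(2) by (intro tail_diff_le) auto
    moreover have "b * tail M X z * (z + \<delta> - z) = tail M X z / 2"
      using arg_cong[OF \<delta>(2), of "\<lambda>x. x * tail M X z"] by simp
    ultimately show ?thesis by linarith
  qed
  have pow: "(1 / 2) ^ n \<le> tail M X (n * \<delta>)" for n
  proof (induction n)
    case (Suc n)
    then show ?case using step[of "n * \<delta>"] \<delta> by (simp add: algebra_simps)
  qed (simp add: tail_props)
  \<comment> \<open>Rounding \<open>z / \<delta>\<close> up costs at most one extra halving, whence
    the factor 1/2 in the statement; \<open>ln 2\<close> is replaced by 1.\<close>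
  define n where "n = nat \<lceil>z / \<delta>\<rceil>"
  have n: "z / \<delta> \<le> n" "real n \<le> z / \<delta> + 1" using z \<delta> by (auto simp: n_def)
  have "exp (- 2 * b * z) / 2 \<le> exp (- ln 2 * (z / \<delta>)) / 2"
    using ln_add_one_self_le_self[of 1] b z by (simp add: \<delta>_def mult_left_le)
  also have "\<dots> = exp (- ln 2 * (z / \<delta> + 1))"
  proof -
    have "exp (- ln 2) = (1 / 2 :: real)" by (simp add: exp_minus)
    then show ?thesis unfolding distrib_left exp_add mult_1_right by simp
  qed
  also have "\<dots> \<le> exp (- ln 2 * n)" using n by simp
  also have "\<dots> = (1 / 2) ^ n" by (simp add: exp_minus exp_of_nat2_mult power_one_over inverse_eq_divide)
  also have "\<dots> \<le> tail M X (n * \<delta>)" by (rule pow)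
  also have "\<dots> \<le> tail M X z" using n \<delta> by (intro tail_props) (simp add: field_simps)
  finally show ?thesis .
qed

text \<open>Over a unit step the density is at least \<open>a\<close> times the tail at the far end.
  Hence each step shrinks the tail by the factor 1/(1 + a), and slicing the half-line into unit
  layers bounds the exponential by a convergent series.\<close>

lemma exp_integrable_of_hazard_ge:
  assumes a: "0 < a" and z1: "0 \<le> z1" and haz: "\<And>z. z1 \<le> z \<Longrightarrow> a * tail M X z \<le> h z"
  shows "\<exists>\<epsilon>>0. integrable M (\<lambda>\<omega>. exp (\<epsilon> * X \<omega>))"
proof -
  note F = has_pos_density_facts[OF d]
  note [measurable] = F(4)
  interpret prob_space M by (rule F(5))
  interpret D: prob_space "distr M borel X" by (rule prob_space_distr) simp
  define q where "q = 1 / (1 + a)"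
  have step: "tail M X (z + 1) \<le> q * tail M X z" if "z1 \<le> z" for z
  proof -
    have "a * tail M X (z + 1) \<le> h u" if "z < u" "u \<le> z + 1" for u
    proof -
      have "a * tail M X (z + 1) \<le> a * tail M X u" using tail_props(1)[of u "z + 1"] that a by simp
      also have "\<dots> \<le> h u" using haz that \<open>z1 \<le> z\<close> by simp
      finally show ?thesis .
    qed
    then have "a * tail M X (z + 1) * (z + 1 - z) \<le> tail M X z - tail M X (z + 1)"
      using that a z1 tail_props(2) by (intro tail_diff_ge) auto
    then show ?thesis using a by (simp add: q_def field_simps)
  qed
  have pow: "tail M X (z1 + n) \<le> q ^ n" for n
  proof (induction n)
    case (Suc n)
    have "tail M X (z1 + n + 1) \<le> q * tail M X (z1 + n)" by (rule step) simp
    also have "\<dots> \<le> q * q ^ n" using Suc a by (intro mult_left_mono) (auto simp: q_def)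
    finally show ?case by (simp add: add_ac)
  qed (simp add: tail_props)
  \<comment> \<open>Half of the decay rate, so that \<open>exp \<epsilon> * q\<close> is (1 +
    a)^(-1/2) < 1.\<close>
  define \<epsilon> where "\<epsilon> = ln (1 + a) / 2"
  have \<epsilon>: "0 < \<epsilon>" using a by (simp add: \<epsilon>_def)
  have eq: "0 \<le> exp \<epsilon> * q" "exp \<epsilon> * q < 1"
  proof -
    have "exp \<epsilon> < exp (ln (1 + a))" using \<epsilon> unfolding exp_less_cancel_iff by (simp add: \<epsilon>_def)
    then show "exp \<epsilon> * q < 1" using a by (simp add: q_def)
  qed (use a in \<open>simp add: q_def\<close>)
  \<comment> \<open>The coefficient is the largest value of the exponential on the layer above z1 +
    n. Using the whole half-line instead of the layer makes the expectation a tail and loses nothing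
    essential.\<close>
  define f where "f n \<omega> = exp (\<epsilon> * (z1 + n + 1)) * indicator {z1 + real n<..} (X \<omega>)" for n :: nat and \<omega>
  have [measurable]: "f n \<in> borel_measurable M" for n unfolding f_def by measurable
  have int_f: "integrable M (f n)" for n
    unfolding f_def by (intro integrable_mult_right integrable_const_bound[where B = 1]) auto
  have If: "(\<integral>\<omega>. norm (f n \<omega>) \<partial>M) = exp (\<epsilon> * (z1 + n + 1)) * tail M X (z1 + n)" for n
  proof -
    have "(\<integral>\<omega>. norm (f n \<omega>) \<partial>M) = exp (\<epsilon> * (z1 + n + 1)) * (\<integral>\<omega>. indicat_real {z1 + real n<..} (X \<omega>) \<partial>M)"
      by (subst integral_mult_right_zero[symmetric]) (simp add: f_def abs_mult)
    also have "(\<integral>\<omega>. indicat_real {z1 + real n<..} (X \<omega>) \<partial>M) = (\<integral>x. indicat_real {z1 + real n<..} x \<partial>distr M borel X)"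
      by (subst integral_distr) auto
    finally show ?thesis by (simp add: tail_def)
  qed
  have "summable (\<lambda>n. \<integral>\<omega>. norm (f n \<omega>) \<partial>M)"
  proof (rule summable_comparison_test')
    show "summable (\<lambda>n. exp (\<epsilon> * (z1 + 1)) * (exp \<epsilon> * q) ^ n)"
      using eq by (intro summable_mult summable_geometric) simp
    show "norm (\<integral>\<omega>. norm (f n \<omega>) \<partial>M) \<le> exp (\<epsilon> * (z1 + 1)) * (exp \<epsilon> * q) ^ n" for n
    proof -
      have "norm (\<integral>\<omega>. norm (f n \<omega>) \<partial>M) \<le> exp (\<epsilon> * (z1 + n + 1)) * q ^ n"
        using pow[of n] tail_props(2) unfolding If by (simp add: abs_mult)
      also have "\<dots> = exp (\<epsilon> * (z1 + 1)) * (exp \<epsilon> * q) ^ n"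
        unfolding power_mult_distrib exp_of_nat_mult[symmetric] mult.assoc[symmetric] exp_add[symmetric]
        by (simp add: algebra_simps)
      finally show ?thesis .
    qed
  qed
  moreover have fin: "finite {n. f n \<omega> \<noteq> 0}" for \<omega>
  proof (rule finite_subset)
    show "{n. f n \<omega> \<noteq> 0} \<subseteq> {..nat \<lceil>X \<omega>\<rceil>}"
      using z1 by (auto simp: f_def split: split_indicator_asm) linarith
  qed simp
  then have sf: "summable (\<lambda>n. f n \<omega>)" for \<omega> by (rule summable_finite) auto
  have "summable (\<lambda>n. norm (f n \<omega>))" for \<omega> using fin[of \<omega>] by (rule summable_finite) auto
  ultimately have int_sum: "integrable M (\<lambda>\<omega>. \<Sum>n. f n \<omega>)"
    using int_f by (intro integrable_suminf) auto
  have "integrable M (\<lambda>\<omega>. exp (\<epsilon> * X \<omega>))"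
  proof (rule Bochner_Integration.integrable_bound)
    show "integrable M (\<lambda>\<omega>. exp (\<epsilon> * z1) + (\<Sum>n. f n \<omega>))"
      using int_sum by (intro Bochner_Integration.integrable_add) auto
    have le: "exp (\<epsilon> * X \<omega>) \<le> exp (\<epsilon> * z1) + (\<Sum>n. f n \<omega>)" for \<omega>
    proof (cases "X \<omega> \<le> z1")
      case True
      then have "exp (\<epsilon> * X \<omega>) \<le> exp (\<epsilon> * z1)" using \<epsilon> by simp
      moreover have "0 \<le> (\<Sum>n. f n \<omega>)" by (intro suminf_nonneg sf) (simp add: f_def)
      ultimately show ?thesis by linarith
    next
      case False
      \<comment> \<open>Ceiling minus one, not floor: the layers are open on the left, to match the
        indicator in \<open>f\<close>.\<close>
      define n where "n = nat (\<lceil>X \<omega> - z1\<rceil> - 1)"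
      have n: "z1 + real n < X \<omega>" "X \<omega> \<le> z1 + real n + 1"
        using False by (auto simp: n_def) linarith+
      have "exp (\<epsilon> * X \<omega>) \<le> f n \<omega>" using n \<epsilon> by (simp add: f_def)
      also have "\<dots> \<le> (\<Sum>n. f n \<omega>)"
      proof -
        have "sum (\<lambda>n. f n \<omega>) {n} \<le> (\<Sum>n. f n \<omega>)"
          by (rule sum_le_suminf[OF sf]) (auto simp: f_def)
        then show ?thesis by simp
      qed
      also have "\<dots> \<le> exp (\<epsilon> * z1) + (\<Sum>n. f n \<omega>)" by simp
      finally show ?thesis .
    qed
    show "AE \<omega> in M. norm (exp (\<epsilon> * X \<omega>)) \<le> norm (exp (\<epsilon> * z1) + (\<Sum>n. f n \<omega>))"
    proof (rule AE_I2)
      fix \<omega>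
      show "norm (exp (\<epsilon> * X \<omega>)) \<le> norm (exp (\<epsilon> * z1) + (\<Sum>n. f n \<omega>))"
        using le[of \<omega>] by simp
    qed
  qed simp
  with \<epsilon> show ?thesis by blast
qed

end

text \<open>One term of the series of exp (y^\<theta>), of order \<open>k\<close> with \<theta> k >=
  - \<beta>, already dominates y^(-\<beta>). This lets polynomial factors be absorbed into stretched
  exponentials.\<close>

lemma powr_ge_exp:
  fixes \<theta> \<beta> :: real
  assumes \<theta>: "0 < \<theta>"
  shows "\<exists>c>0. \<forall>y\<ge>1. c * exp (- (y powr \<theta>)) \<le> y powr \<beta>"
proof -
  define k where "k = nat \<lceil>- \<beta> / \<theta>\<rceil>"
  have k: "- \<beta> \<le> \<theta> * k"
    using \<theta> real_nat_ceiling_ge[of "- \<beta> / \<theta>"] by (simp add: k_def field_simps)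
  have "(1 / fact k) * exp (- (y powr \<theta>)) \<le> y powr \<beta>" if y: "1 \<le> y" for y
  proof -
    have "y powr (- \<beta>) \<le> y powr (\<theta> * k)" using y k by (intro powr_mono) auto
    also have "\<dots> = (y powr \<theta>) ^ k" using y by (simp add: powr_powr[symmetric] powr_realpow)
    also have "\<dots> \<le> fact k * exp (y powr \<theta>)"
      using sum_le_suminf[OF summable_exp_generic[of "y powr \<theta>"], of "{k}"] by (simp add: exp_def field_simps)
    finally have "1 \<le> fact k * exp (y powr \<theta>) * y powr \<beta>"
      using y by (simp add: powr_minus field_simps)
    then show ?thesis by (simp add: exp_minus field_simps)
  qed
  then show ?thesis by (intro exI[of _ "1 / fact k"]) auto
qed

text \<open>Stating the hypothesis through \<open>a < x powr t\<close> covers large \<open>x\<close>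
  for positive \<open>t\<close> and small \<open>x\<close> for negative \<open>t\<close> at once.
  With y = x^t, the factor x^\<beta> and the Jacobian combine to the power \<beta>/t + 1/t - 1 of y,
  which is absorbed by raising \<open>C\<close> to \<open>C + 1\<close>.\<close>

lemma not_M_det_powr_of_density_ge:
  assumes d: "has_pos_density M X h" and t: "t \<noteq> 0" and \<theta>: "0 < \<theta>" "\<theta> < 1 / 2" and a: "1 \<le> a" and c: "0 < c"
    and lower: "\<And>x. 0 < x \<Longrightarrow> a < x powr t \<Longrightarrow> c * x powr \<beta> * exp (- C * x powr (t * \<theta>)) \<le> h x"
  shows "\<not> M_det M (\<lambda>\<omega>. X \<omega> powr t)"
proof -
  obtain e where e: "0 < e" "\<And>y. 1 \<le> y \<Longrightarrow> e * exp (- (y powr \<theta>)) \<le> y powr (\<beta> / t + 1 / t - 1)"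
    using powr_ge_exp[OF \<theta>(1), of "\<beta> / t + 1 / t - 1"] by blast
  have "c * e / \<bar>t\<bar> * exp (- (C + 1) * y powr \<theta>) \<le> h (y powr (1 / t)) * y powr (1 / t - 1) / \<bar>t\<bar>" if y: "a < y" for y
  proof -
    define x where "x = y powr (1 / t)"
    have x: "0 < x" "x powr t = y" "x powr (t * \<theta>) = y powr \<theta>" "x powr \<beta> = y powr (\<beta> / t)"
      using y a t by (auto simp: x_def powr_powr)
    have "c * exp (- C * y powr \<theta>) * (e * exp (- (y powr \<theta>)))
        \<le> c * exp (- C * y powr \<theta>) * y powr (\<beta> / t + 1 / t - 1)"
      using c y a by (intro mult_left_mono e(2)) auto
    also have "\<dots> = c * x powr \<beta> * exp (- C * x powr (t * \<theta>)) * y powr (1 / t - 1)"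
      unfolding x(3,4) using y a by (simp add: powr_add[symmetric] mult_ac add_diff_eq)
    also have "\<dots> \<le> h x * y powr (1 / t - 1)"
      using lower[OF x(1)] y x(2) by (intro mult_right_mono) auto
    finally have "c * exp (- C * y powr \<theta>) * (e * exp (- (y powr \<theta>))) / \<bar>t\<bar> \<le> h x * y powr (1 / t - 1) / \<bar>t\<bar>"
      by (intro divide_right_mono) auto
    moreover have "exp (- C * y powr \<theta>) * exp (- (y powr \<theta>)) = exp (- (C + 1) * y powr \<theta>)"
      by (simp add: exp_add[symmetric] algebra_simps)
    ultimately show ?thesis by (simp add: x_def mult_ac)
  qed
  note lower' = this
  show ?thesis
    by (rule not_M_det_of_density_ge[where a = a, OF has_pos_density_powr[OF d t] \<theta> _ _ lower']) (use a c t e in auto)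
qed

text \<open>\<open>Z\<close> has exponential tails from both sides, so the tail of its
  \<open>r\<close>-th power is of order exp (- c y^(1/r)), and \<open>r = 2\<close> is where 1/r
  crosses 1/2. The boundary belongs to the determinate side: the square root of Z^2 is
  \<open>Z\<close>, whose exponential is integrable.\<close>

lemma M_det_powr_iff_of_hazard:
  assumes d: "has_pos_density M Z f" and a: "0 < a" and b: "0 < b" and s: "0 \<le> s"
    and lo: "\<And>z. s \<le> z \<Longrightarrow> a * tail M Z z \<le> f z"
    and hi: "\<And>z. 0 < z \<Longrightarrow> f z \<le> b * tail M Z z"
    and r: "0 < r"
  shows "M_det M (\<lambda>\<omega>. Z \<omega> powr r) \<longleftrightarrow> r \<le> 2"
proof
  note F = has_pos_density_facts[OF d]
  note [measurable] = F(4)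
  interpret prob_space M by (rule F(5))
  assume r2: "r \<le> 2"
  obtain \<epsilon> where \<epsilon>: "0 < \<epsilon>" "integrable M (\<lambda>\<omega>. exp (\<epsilon> * Z \<omega>))"
    using exp_integrable_of_hazard_ge[OF d a s lo] by blast
  show "M_det M (\<lambda>\<omega>. Z \<omega> powr r)"
  proof (rule M_det_of_exp_sqrt[OF F(5) _ _ \<epsilon>(1)])
    \<comment> \<open>The summand 1 is for small \<open>z\<close>, where z^(r/2) may exceed
      \<open>z\<close>.\<close>
    have le: "sqrt (z powr r) \<le> 1 + z" if "0 < z" for z
    proof (cases "z \<le> 1")
      case True
      then have "z powr r \<le> 1" using that r by (simp add: powr_le1)
      then have "sqrt (z powr r) \<le> 1" by simp
      then show ?thesis using that by linarith
    next
      case False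
      then have "z powr r \<le> z powr 2" using r2 by (intro powr_mono) auto
      also have "\<dots> = z\<^sup>2" using that by (simp add: powr_numeral)
      finally have "sqrt (z powr r) \<le> z" using that by (intro real_le_lsqrt) auto
      then show ?thesis by linarith
    qed
    show "integrable M (\<lambda>x. exp (\<epsilon> * sqrt (Z x powr r)))"
    proof (rule Bochner_Integration.integrable_bound[OF integrable_mult_right[OF \<epsilon>(2), of "exp \<epsilon>"]])
      show "AE x in M. norm (exp (\<epsilon> * sqrt (Z x powr r))) \<le> norm (exp \<epsilon> * exp (\<epsilon> * Z x))"
        using F(9)
      proof eventually_elim
        case (elim x)
        have "\<epsilon> * sqrt (Z x powr r) \<le> \<epsilon> * (1 + Z x)" using le[OF elim] \<epsilon>(1) by simp
        then show ?case by (simp add: exp_add[symmetric] distrib_left)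
      qed
    qed simp
  qed auto
next
  assume det: "M_det M (\<lambda>\<omega>. Z \<omega> powr r)"
  show "r \<le> 2"
  proof (rule ccontr)
    assume "\<not> r \<le> 2"
    then have r2: "2 < r" by simp
    have \<theta>: "0 < 1 / r" "1 / r < 1 / 2" using r2 by (auto simp: field_simps)
    \<comment> \<open>The format of the general criterion with \<beta> = 0 and \<theta> = 1/r; the
      exponent \<open>r * (1 / r)\<close> makes the decay plainly exponential in
      \<open>x\<close>.\<close>
    have "a / 2 * x powr 0 * exp (- (2 * b) * x powr (r * (1 / r))) \<le> f x"
      if x: "0 < x" "max 1 (s powr r) < x powr r" for x
    proof -
      have "s powr r < x powr r" using x by simp
      then have "s \<le> x" using x r powr_mono2[of r x s] by (meson leD le_less linorder_not_le s)
      have "a * (exp (- 2 * b * x) / 2) \<le> a * tail M Z x"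
        using a tail_ge_exp[OF d b hi] x by (intro mult_left_mono) auto
      also have "\<dots> \<le> f x" by (rule lo) fact
      finally show ?thesis using x r by simp
    qed
    note lower = this
    have "\<not> M_det M (\<lambda>\<omega>. Z \<omega> powr r)"
      by (rule not_M_det_powr_of_density_ge[where a = "max 1 (s powr r)" and \<theta> = "1 / r", OF d _ _ _ _ _ lower])
        (use \<theta> r a in auto)
    with det show False by simp
  qed
qed

section \<open>The Frechet case\<close>

text \<open>A negative power exchanges large and small values, so its tail is the mass of
  \<open>X\<close> near 0, the quantity governed by the Frechet equation.\<close>

lemma powr_tail:
  assumes d: "has_pos_density M X h" and x: "0 < x"
  shows "0 < t \<Longrightarrow> tail M (\<lambda>\<omega>. X \<omega> powr t) (x powr t) = tail M X x"
    and "t < 0 \<Longrightarrow> tail M (\<lambda>\<omega>. X \<omega> powr t) (x powr t) = measure (distr M borel X) {0<..<x}"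
proof -
  note F = has_pos_density_facts[OF d]
  note [measurable] = F(4)
  interpret prob_space M by (rule F(5))
  have eq: "tail M (\<lambda>\<omega>. X \<omega> powr t) (x powr t) = measure M {\<omega> \<in> space M. x powr t < X \<omega> powr t}"
    unfolding tail_def by (subst measure_distr) (auto intro!: arg_cong[where f = "measure M"])
  have mono_pos: "x powr t < u powr t \<longleftrightarrow> x < u" if "0 < t" "0 < u" for u
    using that x powr_less_mono2[of t x u] powr_mono2[of t u x] by force
  have mono_neg: "x powr t < u powr t \<longleftrightarrow> u < x" if "t < 0" "0 < u" for u
    using that x powr_less_mono2_neg[of t u x] powr_mono2'[of t x u] by force
  show "tail M (\<lambda>\<omega>. X \<omega> powr t) (x powr t) = tail M X x" if t: "0 < t"
  proof -
    have "measure M {\<omega> \<in> space M. x powr t < X \<omega> powr t} = measure M {\<omega> \<in> space M. x < X \<omega>}"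
      using F(9) t by (intro finite_measure_eq_AE) (auto elim!: eventually_mono simp: mono_pos)
    also have "\<dots> = tail M X x"
      unfolding tail_def by (subst measure_distr) (auto intro!: arg_cong[where f = "measure M"])
    finally show ?thesis using eq by simp
  qed
  show "tail M (\<lambda>\<omega>. X \<omega> powr t) (x powr t) = measure (distr M borel X) {0<..<x}" if t: "t < 0"
  proof -
    have "measure M {\<omega> \<in> space M. x powr t < X \<omega> powr t} = measure M {\<omega> \<in> space M. 0 < X \<omega> \<and> X \<omega> < x}"
      using F(9) t by (intro finite_measure_eq_AE) (auto elim!: eventually_mono simp: mono_neg)
    also have "\<dots> = measure (distr M borel X) {0<..<x}"
      by (subst measure_distr) (auto intro!: arg_cong[where f = "measure M"])
    finally show ?thesis using eq by simp
  qed
qed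

text \<open>Turns pointwise bounds on the kernel into bounds by masses of the law. The lower bound
  may use a smaller set \<open>B\<close>, because the Weibull kernel has no positive lower bound on
  its full range.\<close>

lemma weighted_density_integral_bounds:
  assumes d: "has_pos_density M X h"
    and [measurable]: "A \<in> sets borel" "B \<in> sets borel" "k \<in> borel_measurable borel"
    and A: "A \<subseteq> {0<..}" and BA: "B \<subseteq> A" and k: "\<And>u. u \<in> A \<Longrightarrow> 0 \<le> k u" "\<And>u. u \<in> A \<Longrightarrow> k u \<le> K"
    and kB: "\<And>u. u \<in> B \<Longrightarrow> m \<le> k u"
  shows "(LBINT u:A. h u * k u) \<le> K * measure (distr M borel X) A"
    and "m * measure (distr M borel X) B \<le> (LBINT u:A. h u * k u)"
proof -
  define p where "p y = h y * indicator {0<..} y" for y :: real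
  note F = has_pos_density_facts[OF d, folded p_def]
  note [measurable] = F(1,4)
  note [simp] = F(2)
  have int: "integrable lborel (\<lambda>u. indicator S u * p u)" if [measurable]: "S \<in> sets borel" for S
    by (rule Bochner_Integration.integrable_bound[OF F(7)]) (auto split: split_indicator)
  have meas: "measure (distr M borel X) S = (\<integral>u. indicator S u * p u \<partial>lborel)" if [measurable]: "S \<in> sets borel" for S
  proof -
    have "emeasure (distr M borel X) S = (\<integral>\<^sup>+u. ennreal (p u) * indicator S u \<partial>lborel)"
      unfolding F(3) by (rule emeasure_density) auto
    also have "\<dots> = (\<integral>\<^sup>+u. ennreal (indicator S u * p u) \<partial>lborel)"
      by (intro nn_integral_cong) (auto split: split_indicator)
    also have "\<dots> = ennreal (\<integral>u. indicator S u * p u \<partial>lborel)"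
      by (intro nn_integral_eq_integral int) auto
    finally show ?thesis by (simp add: measure_def)
  qed
  have eq: "indicator A u *\<^sub>R (h u * k u) = indicator A u * p u * k u" for u
    using A by (auto simp: p_def split: split_indicator)
  have int': "integrable lborel (\<lambda>u. indicator A u * p u * k u)"
  proof (rule Bochner_Integration.integrable_bound[OF integrable_mult_left[OF int[of A], of K]])
    have "\<bar>k u\<bar> \<le> \<bar>K\<bar>" if "u \<in> A" for u using k[OF that] by linarith
    then show "AE u in lborel. norm (indicator A u * p u * k u) \<le> norm (indicator A u * p u * K)"
      by (intro AE_I2) (auto simp: abs_mult intro!: mult_left_mono split: split_indicator)
  qed auto
  have "(LBINT u:A. h u * k u) \<le> (\<integral>u. K * (indicator A u * p u) \<partial>lborel)"
    unfolding set_lebesgue_integral_def eq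
    by (intro integral_mono int' integrable_mult_right int)
       (auto split: split_indicator simp: mult.commute[of _ "p _"] intro!: mult_left_mono k(2))
  also have "\<dots> = K * measure (distr M borel X) A" by (simp add: meas)
  finally show "(LBINT u:A. h u * k u) \<le> K * measure (distr M borel X) A" .
  have "m * measure (distr M borel X) B = (\<integral>u. m * (indicator B u * p u) \<partial>lborel)" by (simp add: meas)
  also have "\<dots> \<le> (LBINT u:A. h u * k u)"
    unfolding set_lebesgue_integral_def eq
  proof (intro integral_mono int' integrable_mult_right int)
    fix u
    show "m * (indicator B u * p u) \<le> indicator A u * p u * k u"
      using BA k(1)[of u] kB[of u] by (cases "u \<in> B"; cases "u \<in> A") (auto simp: mult.commute[of _ "p u"] intro!: mult_left_mono)
  qed auto
  finally show "m * measure (distr M borel X) B \<le> (LBINT u:A. h u * k u)" .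
qed

context
  fixes \<alpha> \<gamma> :: real and M :: "'a measure" and X :: "'a \<Rightarrow> real" and h :: "real \<Rightarrow> real"
  assumes \<alpha>: "0 < \<alpha>" "\<alpha> < 1" and \<gamma>: "0 < \<gamma>" and d: "has_pos_density M X h"
    and eq: "\<And>x. 0 < x \<Longrightarrow> h x = \<gamma> / x * (LBINT u:{0<..<x}. h u / (x - \<alpha> * u) powr \<gamma>)"
begin

text \<open>For 0 < u < x the base \<open>x - \<alpha> * u\<close> lies between
  \<open>(1 - \<alpha>) * x\<close> and \<open>x\<close>, so the kernel is comparable to its value
  at \<open>u = 0\<close> throughout.\<close>

lemma frechet_density_bounds:
  assumes x: "0 < x"
  defines "H \<equiv> measure (distr M borel X) {0<..<x}"
  shows "\<gamma> * x powr (- \<gamma> - 1) * H \<le> h x" "h x \<le> (1 - \<alpha>) powr (- \<gamma>) * (\<gamma> * x powr (- \<gamma> - 1) * H)"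
proof -
  have arg: "(1 - \<alpha>) * x \<le> x - \<alpha> * u" "x - \<alpha> * u \<le> x" "0 < x - \<alpha> * u" if "u \<in> {0<..<x}" for u
  proof -
    show "(1 - \<alpha>) * x \<le> x - \<alpha> * u" using that \<alpha> by (simp add: algebra_simps)
    moreover have "0 < (1 - \<alpha>) * x" using \<alpha> x by simp
    ultimately show "0 < x - \<alpha> * u" by linarith
    show "x - \<alpha> * u \<le> x" using that \<alpha> by simp
  qed
  have h: "h x = \<gamma> / x * (LBINT u:{0<..<x}. h u * (x - \<alpha> * u) powr (- \<gamma>))"
    by (subst eq[OF x]) (simp add: powr_minus divide_inverse)
  have lo: "x powr (- \<gamma>) * H \<le> (LBINT u:{0<..<x}. h u * (x - \<alpha> * u) powr (- \<gamma>))"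
    unfolding H_def
    by (rule weighted_density_integral_bounds(2)[OF d, where K = "((1 - \<alpha>) * x) powr (- \<gamma>)"])
       (use arg \<alpha> \<gamma> x in \<open>auto intro!: powr_mono2'\<close>)
  have hi: "(LBINT u:{0<..<x}. h u * (x - \<alpha> * u) powr (- \<gamma>)) \<le> ((1 - \<alpha>) * x) powr (- \<gamma>) * H"
    unfolding H_def
    by (rule weighted_density_integral_bounds(1)[OF d, where B = "{}" and m = 0])
       (use arg \<alpha> \<gamma> x in \<open>auto intro!: powr_mono2'\<close>)
  have xp: "x powr (- \<gamma> - 1) = x powr (- \<gamma>) / x" using x by (simp add: powr_diff)
  have "\<gamma> / x * (x powr (- \<gamma>) * H) \<le> h x"
    unfolding h using \<gamma> x lo by (intro mult_left_mono) auto
  then show "\<gamma> * x powr (- \<gamma> - 1) * H \<le> h x" by (simp add: xp)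
  have "h x \<le> \<gamma> / x * (((1 - \<alpha>) * x) powr (- \<gamma>) * H)"
    unfolding h using \<gamma> x hi by (intro mult_left_mono) auto
  then show "h x \<le> (1 - \<alpha>) powr (- \<gamma>) * (\<gamma> * x powr (- \<gamma> - 1) * H)"
    using \<alpha> x by (simp add: xp powr_mult mult_ac)
qed

text \<open>The Jacobian of the power \<open>- \<gamma>\<close> is
  \<open>x powr (1 + \<gamma>) / \<gamma>\<close>, which cancels the prefactor in
  \<open>frechet_density_bounds\<close> exactly. The hazard rate of
  \<open>X powr (- \<gamma>)\<close> is left between 1 and
  \<open>(1 - \<alpha>) powr (- \<gamma>)\<close>.\<close>

lemma frechet_M_det_iff_pos:
  assumes t: "0 < t"
  shows "M_det M (\<lambda>\<omega>. X \<omega> powr (- t)) \<longleftrightarrow> t \<le> 2 * \<gamma>"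
proof -
  define f where "f y = h (y powr (1 / - \<gamma>)) * y powr (1 / - \<gamma> - 1) / \<bar>- \<gamma>\<bar>" for y
  have dZ: "has_pos_density M (\<lambda>\<omega>. X \<omega> powr (- \<gamma>)) f"
    unfolding f_def using \<gamma> by (intro has_pos_density_powr d) auto
  have bounds: "1 * tail M (\<lambda>\<omega>. X \<omega> powr (- \<gamma>)) z \<le> f z \<and> f z \<le> (1 - \<alpha>) powr (- \<gamma>) * tail M (\<lambda>\<omega>. X \<omega> powr (- \<gamma>)) z" if z: "0 < z" for z
  proof -
    define x where "x = z powr (1 / - \<gamma>)"
    have x: "0 < x" "z = x powr (- \<gamma>)" using z \<gamma> by (auto simp: x_def powr_powr)
    define H where "H = measure (distr M borel X) {0<..<x}"
    have T: "tail M (\<lambda>\<omega>. X \<omega> powr (- \<gamma>)) z = H"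
      unfolding x(2) H_def using powr_tail(2)[OF d x(1), of "- \<gamma>"] \<gamma> by simp
    have "z powr (1 / - \<gamma> - 1) = x powr (1 + \<gamma>)"
      unfolding x(2) powr_powr using \<gamma> by (simp add: right_diff_distrib)
    then have f: "f z = h x * (x powr (1 + \<gamma>) / \<gamma>)"
      using \<gamma> by (simp add: f_def x_def)
    have c: "\<gamma> * x powr (- \<gamma> - 1) * H * (x powr (1 + \<gamma>) / \<gamma>) = H"
    proof -
      have "x powr (- \<gamma> - 1) * x powr (1 + \<gamma>) = 1" using x by (simp add: powr_add[symmetric])
      then show ?thesis using \<gamma> by (simp add: mult_ac)
    qed
    note b = frechet_density_bounds[OF x(1), folded H_def]
    have p: "0 \<le> x powr (1 + \<gamma>) / \<gamma>" using \<gamma> by simp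
    show ?thesis
      unfolding T f using mult_right_mono[OF b(1) p] mult_right_mono[OF b(2) p] c
      by (simp only: mult.assoc mult_1)
  qed
  have "M_det M (\<lambda>\<omega>. (X \<omega> powr (- \<gamma>)) powr (t / \<gamma>)) \<longleftrightarrow> t / \<gamma> \<le> 2"
    \<comment> \<open>The bounds hold for every positive argument, so any positive \<open>s\<close>
      would serve.\<close>
    by (rule M_det_powr_iff_of_hazard[OF dZ, where a = 1 and b = "(1 - \<alpha>) powr (- \<gamma>)" and s = 1])
       (use bounds \<alpha> \<gamma> t in auto)
  then show ?thesis using \<gamma> by (simp add: powr_powr field_simps)
qed

text \<open>Once half of the mass lies below \<open>x\<close>, the density is at least a multiple of
  x^(-\<gamma>-1). Such a tail makes high moments infinite, but it also falls under the general
  perturbation criterion.\<close>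

lemma frechet_not_M_det_neg:
  assumes t: "t < 0"
  shows "\<not> M_det M (\<lambda>\<omega>. X \<omega> powr (- t))"
proof -
  note F = has_pos_density_facts[OF d]
  interpret prob_space M by (rule F(5))
  note [measurable] = F(4)
  interpret D: prob_space "distr M borel X" by (rule prob_space_distr) simp
  have "eventually (\<lambda>x. tail M X x < 1 / 2) at_top"
    using tail_props(5)[OF d] by (rule order_tendstoD) simp
  then obtain x0 where x0: "0 < x0" "tail M X x0 < 1 / 2"
    by (metis (mono_tags, lifting) eventually_at_top_linorder gt_ex le_less less_le_trans linorder_not_le nle_le)
  have H: "1 / 2 \<le> measure (distr M borel X) {0<..<x}" if "x0 < x" for x
  proof -
    have "measure (distr M borel X) ({0<..x0} \<union> {x0<..}) = measure (distr M borel X) {0<..x0} + tail M X x0"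
      unfolding tail_def by (rule D.finite_measure_Union) auto
    moreover have "{0<..x0} \<union> {x0<..} = {0<..}" using x0 by auto
    ultimately have "measure (distr M borel X) {0<..x0} = 1 - tail M X x0"
      using tail_props(4)[OF d] by (simp add: tail_def)
    moreover have "measure (distr M borel X) {0<..x0} \<le> measure (distr M borel X) {0<..<x}"
      using that by (intro D.finite_measure_mono) auto
    ultimately show ?thesis using x0 by linarith
  qed
  \<comment> \<open>A polynomial bound is the case \<open>C = 0\<close>; 1/4 stands for any \<theta>
    in (0, 1/2).\<close>
  have "\<gamma> / 2 * x powr (- \<gamma> - 1) * exp (- 0 * x powr (- t * (1 / 4))) \<le> h x"
    if x: "0 < x" "max 1 (x0 powr (- t)) < x powr (- t)" for x
  proof -
    have "x0 powr (- t) < x powr (- t)" using x by simp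
    then have "x0 < x" using x x0 t powr_mono2[of "- t" x x0] by (meson leD le_less linorder_not_le neg_0_le_iff_le)
    have "\<gamma> * x powr (- \<gamma> - 1) * (1 / 2) \<le> \<gamma> * x powr (- \<gamma> - 1) * measure (distr M borel X) {0<..<x}"
      using \<gamma> H[OF \<open>x0 < x\<close>] by (intro mult_left_mono) auto
    also have "\<dots> \<le> h x" by (rule frechet_density_bounds) fact
    finally show ?thesis by simp
  qed
  note lower = this
  show ?thesis
    by (rule not_M_det_powr_of_density_ge[where a = "max 1 (x0 powr (- t))", OF d _ _ _ _ _ lower]) (use t \<gamma> in auto)
qed

end

section \<open>The Weibull case\<close>

context
  fixes \<alpha> \<gamma> :: real and M :: "'a measure" and X :: "'a \<Rightarrow> real" and h :: "real \<Rightarrow> real"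
  assumes \<alpha>: "0 < \<alpha>" "\<alpha> < 1" and \<gamma>: "0 < \<gamma>" and d: "has_pos_density M X h"
    and eq: "\<And>x. 0 < x \<Longrightarrow> h x = \<gamma> / x * (LBINT u:{x<..<x / \<alpha>}. (x - \<alpha> * u) powr \<gamma> * h u)"
begin

section \<open>Kernel and block estimates\<close>

lemma weibull_density_le:
  assumes x: "0 < x"
  shows "h x \<le> \<gamma> * x powr (\<gamma> - 1) * tail M X x"
proof -
  note F = has_pos_density_facts[OF d]
  note [measurable] = F(4)
  interpret prob_space M by (rule F(5))
  interpret D: prob_space "distr M borel X" by (rule prob_space_distr) simp
  have "(LBINT u:{x<..<x / \<alpha>}. h u * (x - \<alpha> * u) powr \<gamma>) \<le> x powr \<gamma> * measure (distr M borel X) {x<..<x / \<alpha>}"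
  proof (rule weighted_density_integral_bounds(1)[OF d, where B = "{}" and m = 0])
    show "(x - \<alpha> * u) powr \<gamma> \<le> x powr \<gamma>" if "u \<in> {x<..<x / \<alpha>}" for u
      using that \<alpha> \<gamma> x by (intro powr_mono2) (auto simp: field_simps)
  qed (use x in auto)
  also have "\<dots> \<le> x powr \<gamma> * tail M X x"
    unfolding tail_def by (intro mult_left_mono D.finite_measure_mono) auto
  finally have "\<gamma> / x * (LBINT u:{x<..<x / \<alpha>}. h u * (x - \<alpha> * u) powr \<gamma>) \<le> \<gamma> / x * (x powr \<gamma> * tail M X x)"
    using \<gamma> x by (intro mult_left_mono) auto
  then show ?thesis
    by (subst eq[OF x]) (use x in \<open>simp add: mult.commute[of _ "h _"] powr_diff\<close>)
qed

text \<open>The square of the ratio is the midpoint of 1 and 1/\<alpha>, so two consecutive blocks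
  fit strictly inside the reach \<open>x / \<alpha>\<close> of the kernel. Two are needed: seen from
  any point of one block, the next block must be covered completely.\<close>

definition "block_ratio = sqrt ((1 + 1 / \<alpha>) / 2)"
definition "density_rate = \<gamma> * ((1 - \<alpha>) / 2) powr \<gamma>"

lemma block_ratio: "1 < block_ratio" "\<alpha> * block_ratio\<^sup>2 = (1 + \<alpha>) / 2" and density_rate_pos: "0 < density_rate"
proof -
  have "1 < (1 + 1 / \<alpha>) / 2" using \<alpha> by (simp add: field_simps)
  then show "1 < block_ratio" unfolding block_ratio_def by simp
  have "0 \<le> (1 + 1 / \<alpha>) / 2" using \<alpha> by (simp add: field_simps)
  then show "\<alpha> * block_ratio\<^sup>2 = (1 + \<alpha>) / 2" unfolding block_ratio_def using \<alpha> by (simp add: field_simps)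
  show "0 < density_rate" using \<alpha> \<gamma> by (simp add: density_rate_def)
qed

text \<open>Only \<open>u\<close> up to \<open>block_ratio\<^sup>2 * x\<close> is kept. There
  \<open>x - \<alpha> * u\<close> is at least (1 - \<alpha>)/2 times \<open>x\<close>, whereas the
  rest of the range approaches the zero of the kernel.\<close>

lemma weibull_density_ge:
  assumes x: "0 < x"
  shows "density_rate * x powr (\<gamma> - 1) * (tail M X x - tail M X (block_ratio\<^sup>2 * x)) \<le> h x"
proof -
  note F = has_pos_density_facts[OF d]
  note [measurable] = F(4)
  interpret prob_space M by (rule F(5))
  interpret D: prob_space "distr M borel X" by (rule prob_space_distr) simp
  have ratio_2: "1 < block_ratio\<^sup>2" using block_ratio(1) by simp
  have kernel_arg: "(1 - \<alpha>) / 2 * x \<le> x - \<alpha> * u" if "u \<le> block_ratio\<^sup>2 * x" for u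
  proof -
    have "\<alpha> * u \<le> \<alpha> * (block_ratio\<^sup>2 * x)" using that \<alpha> by simp
    also have "\<dots> = (1 + \<alpha>) / 2 * x" using block_ratio(2) by (simp add: mult.assoc[symmetric])
    finally show ?thesis by (simp add: field_simps)
  qed
  have sub: "{x<..block_ratio\<^sup>2 * x} \<subseteq> {x<..<x / \<alpha>}"
  proof
    fix u assume u: "u \<in> {x<..block_ratio\<^sup>2 * x}"
    have "0 < (1 - \<alpha>) / 2 * x" using \<alpha> x by simp
    then have "\<alpha> * u < x" using kernel_arg[of u] u by simp
    then show "u \<in> {x<..<x / \<alpha>}" using u \<alpha> by (simp add: field_simps)
  qed
  have "measure (distr M borel X) ({x<..block_ratio\<^sup>2 * x} \<union> {block_ratio\<^sup>2 * x<..}) = measure (distr M borel X) {x<..block_ratio\<^sup>2 * x} + tail M X (block_ratio\<^sup>2 * x)"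
    unfolding tail_def by (rule D.finite_measure_Union) auto
  moreover have "{x<..block_ratio\<^sup>2 * x} \<union> {block_ratio\<^sup>2 * x<..} = {x<..}" 
  proof -
    have "1 * x \<le> block_ratio\<^sup>2 * x" using ratio_2 x by (intro mult_right_mono) auto
    then show ?thesis by auto
  qed
  ultimately have diff: "measure (distr M borel X) {x<..block_ratio\<^sup>2 * x} = tail M X x - tail M X (block_ratio\<^sup>2 * x)"
    by (simp add: tail_def)
  have "((1 - \<alpha>) / 2 * x) powr \<gamma> * measure (distr M borel X) {x<..block_ratio\<^sup>2 * x} \<le> (LBINT u:{x<..<x / \<alpha>}. h u * (x - \<alpha> * u) powr \<gamma>)"
  proof (rule weighted_density_integral_bounds(2)[OF d])
    show "(x - \<alpha> * u) powr \<gamma> \<le> x powr \<gamma>" if "u \<in> {x<..<x / \<alpha>}" for u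
      using that \<alpha> \<gamma> x by (intro powr_mono2) (auto simp: field_simps)
    show "((1 - \<alpha>) / 2 * x) powr \<gamma> \<le> (x - \<alpha> * u) powr \<gamma>" if "u \<in> {x<..block_ratio\<^sup>2 * x}" for u
    proof (rule powr_mono2)
      show "(1 - \<alpha>) / 2 * x \<le> x - \<alpha> * u" using that by (intro kernel_arg) simp
    qed (use \<alpha> \<gamma> x in auto)
  qed (use x sub in auto)
  then have "\<gamma> / x * (((1 - \<alpha>) / 2 * x) powr \<gamma> * (tail M X x - tail M X (block_ratio\<^sup>2 * x))) \<le> \<gamma> / x * (LBINT u:{x<..<x / \<alpha>}. h u * (x - \<alpha> * u) powr \<gamma>)"
    unfolding diff using \<gamma> x by (intro mult_left_mono) auto
  also have "\<dots> = h x" by (subst eq[OF x]) (simp add: mult.commute[of _ "h _"])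
  also have "\<gamma> / x * (((1 - \<alpha>) / 2 * x) powr \<gamma> * (tail M X x - tail M X (block_ratio\<^sup>2 * x))) = density_rate * x powr (\<gamma> - 1) * (tail M X x - tail M X (block_ratio\<^sup>2 * x))"
    using \<alpha> x by (simp add: density_rate_def powr_mult powr_diff powr_divide mult_ac)
  finally show ?thesis .
qed

text \<open>The middle factor is the loss from replacing u^\<gamma> by its value at the left end of
  a block, the last one the length of the block relative to its right end.\<close>

definition "mass_gain = density_rate * block_ratio powr (- \<gamma>) * (1 - 1 / block_ratio)"

lemma mass_gain_pos: "0 < mass_gain"
  using density_rate_pos block_ratio by (simp add: mass_gain_def)

text \<open>For \<open>u\<close> in the block ending at \<open>y\<close>, the window from
  \<open>u\<close> to \<open>block_ratio\<^sup>2 * u\<close> contains the block starting at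
  \<open>y\<close>. So the density at every such \<open>u\<close> is bounded below by the mass of
  that next block, and integration over \<open>u\<close> gives the claim.\<close>

lemma weibull_mass_step:
  assumes y: "0 < y"
  shows "mass_gain * y powr \<gamma> * (tail M X y - tail M X (block_ratio * y)) \<le> tail M X (y / block_ratio) - tail M X y"
proof -
  have y_ratio: "0 < y / block_ratio" "y / block_ratio \<le> y" using y block_ratio(1) by (auto simp: field_simps)
  have D: "0 \<le> tail M X y - tail M X (block_ratio * y)"
    using tail_props(1)[OF d, of y "block_ratio * y"] y block_ratio(1) mult_right_mono[of 1 block_ratio y] by simp
  have "density_rate * (block_ratio powr (- \<gamma>) * y powr \<gamma> / y) * (tail M X y - tail M X (block_ratio * y)) * (y - y / block_ratio) \<le> tail M X (y / block_ratio) - tail M X y"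
  proof (rule tail_diff_ge[OF d])
    fix u assume u: "y / block_ratio < u" "u \<le> y"
    then have u0: "0 < u" using y_ratio by linarith
    \<comment> \<open>Numerator and denominator of u^\<gamma>/u are estimated at opposite ends of
      the block, which avoids a distinction by the sign of \<gamma> - 1.\<close>
    have "block_ratio powr (- \<gamma>) * y powr \<gamma> / y = (y / block_ratio) powr \<gamma> / y"
      using block_ratio(1) y by (simp add: powr_divide powr_minus_divide)
    also have "\<dots> \<le> u powr \<gamma> / u"
      using u u0 y_ratio \<gamma> by (intro frac_le powr_mono2) auto
    also have "\<dots> = u powr (\<gamma> - 1)" using u0 by (simp add: powr_diff)
    finally have 1: "block_ratio powr (- \<gamma>) * y powr \<gamma> / y \<le> u powr (\<gamma> - 1)" .
    have "block_ratio * y \<le> block_ratio\<^sup>2 * u"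
    proof -
      have "y \<le> block_ratio * u" using u block_ratio(1) by (simp add: field_simps)
      then show ?thesis using block_ratio(1) by (simp add: power2_eq_square)
    qed
    then have 2: "tail M X y - tail M X (block_ratio * y) \<le> tail M X u - tail M X (block_ratio\<^sup>2 * u)"
      using tail_props(1)[OF d u(2)] tail_props(1)[OF d] by (meson diff_mono)
    have "density_rate * (block_ratio powr (- \<gamma>) * y powr \<gamma> / y) * (tail M X y - tail M X (block_ratio * y)) \<le> density_rate * u powr (\<gamma> - 1) * (tail M X u - tail M X (block_ratio\<^sup>2 * u))"
      using 1 2 density_rate_pos D y by (intro mult_mono) auto
    also have "\<dots> \<le> h u" by (rule weibull_density_ge[OF u0])
    finally show "density_rate * (block_ratio powr (- \<gamma>) * y powr \<gamma> / y) * (tail M X y - tail M X (block_ratio * y)) \<le> h u" .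
  qed (use y_ratio density_rate_pos D y in auto)
  also have "density_rate * (block_ratio powr (- \<gamma>) * y powr \<gamma> / y) * (tail M X y - tail M X (block_ratio * y)) * (y - y / block_ratio) = mass_gain * y powr \<gamma> * (tail M X y - tail M X (block_ratio * y))"
    using y block_ratio(1) by (simp add: mass_gain_def field_simps)
  finally show ?thesis .
qed

text \<open>For large arguments the mass of a block beats that of the next block by a factor two, so the
  tail telescopes to at most twice its first block.\<close>

lemma weibull_tail_halving:
  obtains y1 where "0 < y1" "\<And>y. y1 \<le> y \<Longrightarrow> tail M X (block_ratio * y) \<le> tail M X y / 2"
proof -
  \<comment> \<open>Solves \<open>mass_gain * y0 powr \<gamma> = 2\<close>, the point from which a
    block has at least twice the mass of the next.\<close>
  define y0 where "y0 = (2 / mass_gain) powr (1 / \<gamma>)"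
  have y0: "0 < y0" using mass_gain_pos by (simp add: y0_def)
  have step: "2 * (tail M X y - tail M X (block_ratio * y)) \<le> tail M X (y / block_ratio) - tail M X y" if y: "y0 \<le> y" for y
  proof -
    have "2 / mass_gain = y0 powr \<gamma>" using \<gamma> mass_gain_pos by (simp add: y0_def powr_powr)
    also have "\<dots> \<le> y powr \<gamma>" using y y0 \<gamma> by (intro powr_mono2) auto
    finally have "2 \<le> mass_gain * y powr \<gamma>" using mass_gain_pos by (simp add: field_simps)
    moreover have "0 \<le> tail M X y - tail M X (block_ratio * y)"
      using tail_props(1)[OF d, of y "block_ratio * y"] y y0 block_ratio(1) mult_right_mono[of 1 block_ratio y] by simp
    ultimately have "2 * (tail M X y - tail M X (block_ratio * y)) \<le> mass_gain * y powr \<gamma> * (tail M X y - tail M X (block_ratio * y))"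
      by (rule mult_right_mono)
    also have "\<dots> \<le> tail M X (y / block_ratio) - tail M X y" using y y0 by (intro weibull_mass_step) auto
    finally show ?thesis .
  qed
  \<comment> \<open>Adding \<open>step\<close> over n successive blocks: both sides telescope, the
    right one with all its end points divided by \<open>block_ratio\<close>.\<close>
  have tele: "2 * (tail M X y - tail M X (block_ratio ^ n * y)) \<le> tail M X (y / block_ratio) - tail M X (block_ratio ^ n * y / block_ratio)" if y: "y0 \<le> y" for y n
  proof (induction n)
    case (Suc n)
    have "y0 \<le> block_ratio ^ n * y"
    proof -
      have "1 \<le> block_ratio ^ n" using block_ratio(1) by (simp add: one_le_power)
      then have "1 * y \<le> block_ratio ^ n * y" using y y0 by (intro mult_right_mono) auto
      then show ?thesis using y by linarith
    qed
    from step[OF this] Suc block_ratio(1) show ?case by (simp add: mult_ac)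
  qed simp
  have half: "tail M X y \<le> tail M X (y / block_ratio) / 2" if y: "y0 \<le> y" for y
  proof -
    have lim: "filterlim (\<lambda>n. block_ratio ^ n * y) at_top sequentially"
    proof -
      have "0 < y" using y y0 by linarith
      then show ?thesis using block_ratio(1) by real_asymp
    qed
    have "(\<lambda>n. 2 * (tail M X y - tail M X (block_ratio ^ n * y))) \<longlonglongrightarrow> 2 * (tail M X y - 0)"
      by (intro tendsto_intros filterlim_compose[OF tail_props(5)[OF d] lim])
    moreover have "2 * (tail M X y - tail M X (block_ratio ^ n * y)) \<le> tail M X (y / block_ratio)" for n
      using tele[OF y, of n] tail_props(2)[OF d, of "block_ratio ^ n * y / block_ratio"] by linarith
    ultimately have "2 * (tail M X y - 0) \<le> tail M X (y / block_ratio)" by (intro LIMSEQ_le_const2) auto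
    then show ?thesis by simp
  qed
  show ?thesis
  proof
    show "0 < y0" by fact
    fix y assume "y0 \<le> y"
    moreover from this have "y \<le> block_ratio * y" using y0 block_ratio(1) mult_right_mono[of 1 block_ratio y] by simp
    ultimately show "tail M X (block_ratio * y) \<le> tail M X y / 2" using half[of "block_ratio * y"] block_ratio(1) by simp
  qed
qed

text \<open>The upper bound 1 comes from kernel <= x^\<gamma>. In the lower bound the 2 is the price
  of discarding the tail beyond \<open>block_ratio\<^sup>2 * x\<close>, at most half of the total,
  and \<gamma> comes from the Jacobian.\<close>

lemma weibull_hazard:
  obtains a f where "0 < a" "has_pos_density M (\<lambda>\<omega>. X \<omega> powr \<gamma>) f"
    "\<And>z. 0 < z \<Longrightarrow> f z \<le> 1 * tail M (\<lambda>\<omega>. X \<omega> powr \<gamma>) z"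
    "\<exists>z1\<ge>0. \<forall>z\<ge>z1. a * tail M (\<lambda>\<omega>. X \<omega> powr \<gamma>) z \<le> f z"
proof -
  define f where "f y = h (y powr (1 / \<gamma>)) * y powr (1 / \<gamma> - 1) / \<bar>\<gamma>\<bar>" for y
  have dZ: "has_pos_density M (\<lambda>\<omega>. X \<omega> powr \<gamma>) f"
    unfolding f_def using \<gamma> by (intro has_pos_density_powr d) auto
  have fx: "f (x powr \<gamma>) = h x * (x powr (1 - \<gamma>) / \<gamma>)" "tail M (\<lambda>\<omega>. X \<omega> powr \<gamma>) (x powr \<gamma>) = tail M X x"
    "x powr (\<gamma> - 1) * x powr (1 - \<gamma>) = 1" if "0 < x" for x
    using that \<gamma> powr_tail(1)[OF d that, of \<gamma>]
    by (auto simp: f_def powr_powr right_diff_distrib powr_add[symmetric])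
  have inv: "z = (z powr (1 / \<gamma>)) powr \<gamma>" if "0 < z" for z using that \<gamma> by (simp add: powr_powr)
  have hi: "f z \<le> 1 * tail M (\<lambda>\<omega>. X \<omega> powr \<gamma>) z" if z: "0 < z" for z
  proof -
    define x where "x = z powr (1 / \<gamma>)"
    have x: "0 < x" "z = x powr \<gamma>" using z inv by (auto simp: x_def)
    have "h x * (x powr (1 - \<gamma>) / \<gamma>) \<le> \<gamma> * x powr (\<gamma> - 1) * tail M X x * (x powr (1 - \<gamma>) / \<gamma>)"
      using \<gamma> by (intro mult_right_mono weibull_density_le x) auto
    also have "\<dots> = (x powr (\<gamma> - 1) * x powr (1 - \<gamma>)) * tail M X x" using \<gamma> by simp
    finally show ?thesis unfolding x(2) fx[OF x(1)] by simp
  qed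
  obtain y1 where y1: "0 < y1" "\<And>y. y1 \<le> y \<Longrightarrow> tail M X (block_ratio * y) \<le> tail M X y / 2" by (rule weibull_tail_halving) blast
  have lo: "density_rate / (2 * \<gamma>) * tail M (\<lambda>\<omega>. X \<omega> powr \<gamma>) z \<le> f z" if z: "y1 powr \<gamma> \<le> z" for z
  proof -
    have "0 < y1 powr \<gamma>" using y1 by simp
    then have z0: "0 < z" using z by linarith
    define x where "x = z powr (1 / \<gamma>)"
    have x: "0 < x" "z = x powr \<gamma>" using z0 inv by (auto simp: x_def)
    have "y1 = (y1 powr \<gamma>) powr (1 / \<gamma>)" using y1 \<gamma> by (simp add: powr_powr)
    also have "\<dots> \<le> x" unfolding x_def using z y1 \<gamma> by (intro powr_mono2) auto
    finally have y1x: "y1 \<le> x" .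
    have "block_ratio * x \<le> block_ratio\<^sup>2 * x" using block_ratio(1) x by (simp add: power2_eq_square)
    then have "tail M X (block_ratio\<^sup>2 * x) \<le> tail M X x / 2" using tail_props(1)[OF d] y1(2)[OF y1x] by (meson order_trans)
    then have "density_rate * x powr (\<gamma> - 1) * (tail M X x / 2) \<le> density_rate * x powr (\<gamma> - 1) * (tail M X x - tail M X (block_ratio\<^sup>2 * x))"
      using density_rate_pos by (intro mult_left_mono) auto
    also have "\<dots> \<le> h x" by (rule weibull_density_ge[OF x(1)])
    finally have "density_rate * x powr (\<gamma> - 1) * (tail M X x / 2) * (x powr (1 - \<gamma>) / \<gamma>) \<le> f z"
      unfolding x(2) fx[OF x(1)] using \<gamma> by (intro mult_right_mono) auto
    moreover have "density_rate * x powr (\<gamma> - 1) * (tail M X x / 2) * (x powr (1 - \<gamma>) / \<gamma>) = density_rate / (2 * \<gamma>) * tail M X x * (x powr (\<gamma> - 1) * x powr (1 - \<gamma>))"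
      by simp
    ultimately show ?thesis unfolding x(2) fx[OF x(1)] by (simp only: mult_1_right)
  qed
  show ?thesis
  proof (rule that[OF _ dZ hi])
    show "0 < density_rate / (2 * \<gamma>)" using density_rate_pos \<gamma> by simp
    show "\<exists>z1\<ge>0. \<forall>z\<ge>z1. density_rate / (2 * \<gamma>) * tail M (\<lambda>\<omega>. X \<omega> powr \<gamma>) z \<le> f z"
      using lo by (intro exI[of _ "y1 powr \<gamma>"]) simp
  qed
qed

section \<open>Positive and negative powers in the Weibull case\<close>

lemma weibull_M_det_iff_pos:
  assumes t: "0 < t"
  shows "M_det M (\<lambda>\<omega>. X \<omega> powr t) \<longleftrightarrow> t \<le> 2 * \<gamma>"
proof -
  obtain a f z1 where "0 < a" "has_pos_density M (\<lambda>\<omega>. X \<omega> powr \<gamma>) f"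
    "\<And>z. 0 < z \<Longrightarrow> f z \<le> 1 * tail M (\<lambda>\<omega>. X \<omega> powr \<gamma>) z"
    "0 \<le> z1" "\<And>z. z1 \<le> z \<Longrightarrow> a * tail M (\<lambda>\<omega>. X \<omega> powr \<gamma>) z \<le> f z"
    using weibull_hazard by metis
  then have "M_det M (\<lambda>\<omega>. (X \<omega> powr \<gamma>) powr (t / \<gamma>)) \<longleftrightarrow> t / \<gamma> \<le> 2"
    using t \<gamma> by (intro M_det_powr_iff_of_hazard[where b = 1]) auto
  then show ?thesis using \<gamma> by (simp add: powr_powr field_simps)
qed

text \<open>A bounded hazard rate never exhausts the mass. This makes the starting value of the
  iteration towards 0 strictly positive.\<close>

lemma weibull_tail_pos:
  assumes "0 < x"
  shows "0 < tail M X x"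
proof -
  obtain a f where f: "has_pos_density M (\<lambda>\<omega>. X \<omega> powr \<gamma>) f"
    "\<And>z. 0 < z \<Longrightarrow> f z \<le> 1 * tail M (\<lambda>\<omega>. X \<omega> powr \<gamma>) z"
    by (rule weibull_hazard) blast
  have "exp (- 2 * 1 * x powr \<gamma>) / 2 \<le> tail M (\<lambda>\<omega>. X \<omega> powr \<gamma>) (x powr \<gamma>)"
    by (rule tail_ge_exp[OF f(1) _ f(2)]) auto
  then have "exp (- 2 * 1 * x powr \<gamma>) / 2 \<le> tail M X x" using powr_tail(1)[OF d assms \<gamma>] by simp
  then show ?thesis using exp_gt_zero[of "- 2 * 1 * x powr \<gamma>"] by linarith
qed

text \<open>Iterating \<open>weibull_mass_step\<close> downwards yields a bound of log-normal type; the weaker bound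
  stated here is closed under the iteration and easier to carry.\<close>

lemma weibull_mass_near_zero:
  assumes p: "0 < p"
  obtains c C y1 where "0 < c" "0 < y1" "\<And>y. 0 < y \<Longrightarrow> y \<le> y1 \<Longrightarrow> c * exp (- C * y powr (- p)) \<le> tail M X y - tail M X (block_ratio * y)"
proof -
  obtain y1 where y1: "0 < y1" "\<And>y. y1 \<le> y \<Longrightarrow> tail M X (block_ratio * y) \<le> tail M X y / 2" by (rule weibull_tail_halving) blast
  \<comment> \<open>For \<open>y\<close> between \<open>y1\<close> and
    \<open>block_ratio * y1\<close> the block at \<open>y\<close> carries at least half the tail at
    \<open>y\<close>, and monotonicity makes this bound uniform.\<close>
  define c where "c = tail M X (block_ratio * y1) / 2"
  have c: "0 < c" using weibull_tail_pos[of "block_ratio * y1"] y1 block_ratio(1) by (simp add: c_def)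
  have base: "c \<le> tail M X y - tail M X (block_ratio * y)" if y: "y1 \<le> y" "y \<le> block_ratio * y1" for y
    using y1(2)[OF y(1)] tail_props(1)[OF d y(2)] by (simp add: c_def)
  obtain e where e: "0 < e" "\<And>y. 1 \<le> y \<Longrightarrow> e * exp (- (y powr p)) \<le> y powr (- \<gamma>)"
    using powr_ge_exp[OF p, of "- \<gamma>"] by blast
  \<comment> \<open>Capping at 1 extends the bound to s > 1, where s^\<gamma> >= 1.\<close>
  define e1 where "e1 = min e 1"
  have pow: "e1 * exp (- (s powr (- p))) \<le> s powr \<gamma>" if s: "0 < s" for s
  proof (cases "s \<le> 1")
    case True
    have "e1 * exp (- (s powr (- p))) \<le> e * exp (- (s powr (- p)))" by (simp add: e1_def)
    also have "\<dots> \<le> s powr \<gamma>"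
    proof -
      have "(1 / s) powr p = s powr (- p)" "(1 / s) powr (- \<gamma>) = s powr \<gamma>"
        using s by (simp_all add: powr_divide powr_minus_divide)
      then show ?thesis using e(2)[of "1 / s"] s True by simp
    qed
    finally show ?thesis .
  next
    case False
    have "e1 * exp (- (s powr (- p))) \<le> 1 * 1" using e by (intro mult_mono) (auto simp: e1_def)
    also have "\<dots> \<le> s powr \<gamma>" using False \<gamma> by (simp add: ge_one_powr_ge_zero)
    finally show ?thesis by simp
  qed
  \<comment> \<open>Rewrites the constant \<open>mass_gain * e1\<close> as part of the exponential:
    up to \<open>block_ratio * y1\<close>, its logarithm is at most \<open>L * y powr (- p)\<close>
    in absolute value.\<close>
  define L where "L = \<bar>ln (mass_gain * e1)\<bar> * (block_ratio * y1) powr p"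
  have Be: "0 < mass_gain * e1" using mass_gain_pos e by (simp add: e1_def)
  have factor: "exp (- (1 + L) * y powr (- p)) \<le> mass_gain * y powr \<gamma>" if y: "0 < y" "y \<le> block_ratio * y1" for y
  proof -
    have "\<bar>ln (mass_gain * e1)\<bar> * y powr p \<le> L" unfolding L_def using y p by (intro mult_left_mono powr_mono2) auto
    then have "\<bar>ln (mass_gain * e1)\<bar> \<le> L * y powr (- p)" using y by (simp add: powr_minus field_simps)
    then have "- L * y powr (- p) \<le> ln (mass_gain * e1)" by linarith
    then have "exp (- L * y powr (- p)) \<le> exp (ln (mass_gain * e1))" by (simp only: exp_le_cancel_iff)
    then have "exp (- L * y powr (- p)) * exp (- (y powr (- p))) \<le> (mass_gain * e1) * exp (- (y powr (- p)))"
      using Be by (intro mult_right_mono) auto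
    also have "\<dots> \<le> mass_gain * y powr \<gamma>" using pow[OF y(1)] mass_gain_pos by (simp add: mult.assoc)
    finally show ?thesis by (simp add: exp_add[symmetric] algebra_simps)
  qed
  have L0: "0 \<le> L" by (simp add: L_def)
  have ratio_p: "1 < block_ratio powr p" using block_ratio(1) p by (simp add: gr_one_powr)
  \<comment> \<open>The fixed point that closes the induction. One step from
    \<open>block_ratio * y\<close> down to \<open>y\<close> costs \<open>1 + L\<close> in the
    exponent, and this is recovered because y^(-p) is \<open>block_ratio powr p\<close> times its
    value at \<open>block_ratio * y\<close>.\<close>
  define C where "C = (1 + L) / (block_ratio powr p - 1)"
  have C: "0 \<le> C" "1 + L + C = C * block_ratio powr p" using L0 ratio_p by (auto simp: C_def field_simps)
  have ind: "c * exp (- C * y powr (- p)) \<le> tail M X y - tail M X (block_ratio * y)" if "y1 / block_ratio ^ n \<le> y" "y \<le> block_ratio * y1" for n y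
    using that
  proof (induction n arbitrary: y)
    case 0
    have "c * exp (- C * y powr (- p)) \<le> c * 1" using c C by (intro mult_left_mono) auto
    then show ?case using base[of y] 0 by simp
  next
    case (Suc n)
    have y0: "0 < y" using Suc.prems(1) y1 block_ratio(1) by (meson divide_pos_pos less_le_trans less_trans zero_less_one zero_less_power)
    show ?case
    proof (cases "y1 \<le> y")
      case True
      have "c * exp (- C * y powr (- p)) \<le> c * 1" using c C by (intro mult_left_mono) auto
      then show ?thesis using base[of y] Suc.prems True by simp
    next
      case False
      have y': "y1 / block_ratio ^ n \<le> block_ratio * y" "block_ratio * y \<le> block_ratio * y1" "0 < block_ratio * y"
        using Suc.prems(1) False block_ratio(1) y0 by (auto simp: field_simps)
      define D where "D = c * exp (- C * (block_ratio * y) powr (- p))"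
      have "block_ratio powr p * (block_ratio * y) powr (- p) = y powr (- p)"
        using block_ratio(1) y0 by (simp add: powr_mult powr_minus)
      then have e: "- C * y powr (- p) = - (1 + L) * (block_ratio * y) powr (- p) + - C * (block_ratio * y) powr (- p)"
        using C(2) by (metis (no_types, lifting) add.commute distrib_right minus_add_distrib minus_mult_left mult.assoc)
      have "c * exp (- C * y powr (- p)) = exp (- (1 + L) * (block_ratio * y) powr (- p)) * D"
        unfolding e exp_add D_def by simp
      also have "\<dots> \<le> (mass_gain * (block_ratio * y) powr \<gamma>) * (tail M X (block_ratio * y) - tail M X (block_ratio * (block_ratio * y)))"
        using c Suc.IH[OF y'(1,2)] factor[OF y'(3,2)] mass_gain_pos unfolding D_def by (intro mult_mono) auto
      also have "\<dots> \<le> tail M X (block_ratio * y / block_ratio) - tail M X (block_ratio * y)" by (rule weibull_mass_step[OF y'(3)])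
      also have "block_ratio * y / block_ratio = y" using block_ratio(1) by simp
      finally show ?thesis .
    qed
  qed
  show ?thesis
  proof (rule that[OF c y1(1)])
    fix y assume y: "0 < y" "y \<le> y1"
    obtain n where "y1 / y < block_ratio ^ n" using real_arch_pow[OF block_ratio(1)] by blast
    then have "y1 / block_ratio ^ n \<le> y" using y block_ratio(1) by (simp add: field_simps)
    moreover have "y \<le> block_ratio * y1" 
    proof -
      have "1 * y1 \<le> block_ratio * y1" using y1 block_ratio(1) by (intro mult_right_mono) auto
      then show ?thesis using y by linarith
    qed
    ultimately show "c * exp (- C * y powr (- p)) \<le> tail M X y - tail M X (block_ratio * y)" by (rule ind)
  qed
qed

lemma weibull_not_M_det_neg:
  assumes t: "t < 0"
  shows "\<not> M_det M (\<lambda>\<omega>. X \<omega> powr t)"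
proof -
  \<comment> \<open>With p = - t/4 the bound reads exp (- C y^(1/4)) in the variable y = x^t, so
    \<theta> = 1/4 is admissible.\<close>
  have "0 < - t / 4" using t by simp
  then obtain c C y1 where c: "0 < c" "0 < y1"
    "\<And>y. 0 < y \<Longrightarrow> y \<le> y1 \<Longrightarrow> c * exp (- C * y powr (- (- t / 4))) \<le> tail M X y - tail M X (block_ratio * y)"
    by (rule weibull_mass_near_zero) blast
  have "density_rate * c * x powr (\<gamma> - 1) * exp (- C * x powr (t * (1 / 4))) \<le> h x"
    if x: "0 < x" "max 1 (y1 powr t) < x powr t" for x
  proof -
    have "y1 powr t < x powr t" using x by simp
    then have "x \<le> y1" using x c t powr_mono2'[of t y1 x] by (meson leD le_less linorder_not_le)
    have "block_ratio * x \<le> block_ratio\<^sup>2 * x" using block_ratio(1) x by (simp add: power2_eq_square)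
    then have "tail M X (block_ratio\<^sup>2 * x) \<le> tail M X (block_ratio * x)" by (rule tail_props(1)[OF d])
    then have "c * exp (- C * x powr (t * (1 / 4))) \<le> tail M X x - tail M X (block_ratio\<^sup>2 * x)"
      using c(3)[OF x(1) \<open>x \<le> y1\<close>] by simp
    then have "density_rate * x powr (\<gamma> - 1) * (c * exp (- C * x powr (t * (1 / 4)))) \<le> density_rate * x powr (\<gamma> - 1) * (tail M X x - tail M X (block_ratio\<^sup>2 * x))"
      using density_rate_pos by (intro mult_left_mono) auto
    also have "\<dots> \<le> h x" by (rule weibull_density_ge[OF x(1)])
    finally show ?thesis by (simp add: mult_ac)
  qed
  note lower = this
  show ?thesis
    by (rule not_M_det_powr_of_density_ge[where a = "max 1 (y1 powr t)", OF d _ _ _ _ _ lower]) (use t density_rate_pos c in auto)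
qed

end

section \<open>Both laws together, by the sign of the exponent\<close>

theorem theorem4:
  fixes \<alpha> \<gamma> t :: real
    and M :: "'a measure" and X :: "'a \<Rightarrow> real"
    and M' :: "'b measure" and X' :: "'b \<Rightarrow> real"
  assumes "0 < \<alpha>" and "\<alpha> < 1" and "0 < \<gamma>" and "t \<noteq> 0"
    and "sun_frechet \<alpha> \<gamma> M X"
    and "sun_weibull \<alpha> \<gamma> M' X'"
  shows "(M_det M' (\<lambda>\<omega>. X' \<omega> powr t) \<longleftrightarrow> 0 < t \<and> t \<le> 2 * \<gamma>) \<and>
         (0 < t \<and> t \<le> 2 * \<gamma> \<longleftrightarrow> M_det M (\<lambda>\<omega>. X \<omega> powr (- t)))"
proof -
  obtain h where h: "has_pos_density M X h"
    "\<And>x. 0 < x \<Longrightarrow> h x = \<gamma> / x * (LBINT u:{0<..<x}. h u / (x - \<alpha> * u) powr \<gamma>)"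
    using assms(5) unfolding sun_frechet_def by blast
  obtain h' where h': "has_pos_density M' X' h'"
    "\<And>x. 0 < x \<Longrightarrow> h' x = \<gamma> / x * (LBINT u:{x<..<x / \<alpha>}. (x - \<alpha> * u) powr \<gamma> * h' u)"
    using assms(6) unfolding sun_weibull_def by blast
  show ?thesis
  proof (cases "0 < t")
    case True
    then show ?thesis
      using frechet_M_det_iff_pos[OF assms(1-3) h True] weibull_M_det_iff_pos[OF assms(1-3) h' True] by simp
  next
    case False
    then have t: "t < 0" using assms(4) by simp
    then show ?thesis
      using frechet_not_M_det_neg[OF assms(1-3) h t] weibull_not_M_det_neg[OF assms(1-3) h' t] by simp
  qed
qed

end
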